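(* Let $\Lambda\subseteq\mathbb{Z}_{\ge0}^k$ be a non-exceptional Young diagram of dimension $k$, and let $B=\{b_\mu\in\mathbb{K}\mid\mu\in\mathrm{corn}(\Lambda)\}$ be a set of constants at least one of which is non-zero. Consider the $H$-pair $(A_{\Lambda,B},U_{\Lambda,B})$ associated with $(\Lambda,B)$ and the corresponding projective hypersurface $X=\{f(z)=0\}\subseteq\mathbb{P}^n=\mathbb{P}(A_{\Lambda,B})$ of degree $d$ admitting an induced additive action, where $f=z_0^d\pi(\ln(1+z/z_0))$ and $\pi(z)=z_{\mathrm{corn}}$. Then $$d=\max_{\substack{\mu\in\mathrm{corn}(\Lambda)\\ b_\mu\ne0}}|\mu|,$$ and the polynomials $f_d$, $f_{d-1}$ in the decomposition $f=\sum_{s=1}^d z_0^{d-s}f_s$ (with $f_s$ homogeneous of degree $s$ in the coordinates other than $z_0$) are as follows: $$f_d=\frac{(-1)^{d-1}}{d}\sum_{\substack{\mu\in\mathrm{corn}(\Lambda)\\ |\mu|=d}}c_\mu b_\mu z^\mu,$$ $$f_{d-1}=\frac{(-1)^{d-2}}{d-1}\sum_{\substack{\mu\in\mathrm{corn}(\Lambda)\\ |\mu|=d-1}}c_\mu b_\mu z^\mu+(-1)^{d-2}\sum_{\substack{\mu\in\mathrm{corn}(\Lambda)\\ |\mu|=d}}\ \sum_{\substack{|\nu|=2\\ \nu\preccurlyeq\mu}}c_{\mu-\nu}b_\mu z_\nu z^{\mu-\nu},$$ where $c_\mu=\frac{(\mu_1+\ldots+\mu_k)!}{\mu_1!\cdots\mu_k!}$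 denotes the multinomial coefficient.
   Context: The base field $\mathbb{K}$ is algebraically closed of characteristic zero. Let $k\in\mathbb{Z}_{>0}$; $e_1,\ldots,e_k$ is the standard basis of $\mathbb{Z}^k$. On $\mathbb{Z}_{\ge0}^k$ consider the product order: $\lambda\preccurlyeq\mu$ means $\lambda_i\le\mu_i$ for all $i$. A Young diagram of dimension $k$ is a finite subset $\Lambda\subseteq\mathbb{Z}_{\ge0}^k$ such that $\mu\in\Lambda$, $\lambda\in\mathbb{Z}_{\ge 0}^k$ and $\lambda\preccurlyeq\mu$ imply $\lambda\in\Lambda$; it is assumed that for any $1\le i\le k$ there is $\lambda\in\Lambda$ with $\lambda_i\ne0$. A corner cell is a maximal element of $\Lambda$ with respect to $\preccurlyeq$; the set of corner cells is $\mathrm{corn}(\Lambda)$. $\Lambda$ is exceptional with respect to the $i$-th coordinate if every $\lambda\in\Lambda$ satisfies $\lambda_i=0$ or $\lambda=e_i$, and non-exceptional if this holds for no $i$. Write $|\lambda|=\lambda_1+\ldots+\lambda_k$ and $x^\lambda=x_1^{\lambda_1}\cdots x_k^{\lambda_k}$. The algebra $A_{\Lambda,B}$ is the quotient of $\mathbb{K}[x_1,\ldots,x_k]$ by the relations $x^\lambda=0$ for $\lambda\in\mathbb{Z}_{\ge0}^k\setminus\Lambda$ and $b_\nu x^\mu=b_\mu x^\nu$ for $\mu,\nu\in\mathrm{corn}(\Lambda)$. $U_{\Lambda,B}$ is the linear span of $x^\lambda$, $\lambda\in\Lambda\setminus(\mathrm{corn}(\Lambda)\cup\{0\})$. There is a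 non-zero element $x^{\mathrm{corn}}\in A_{\Lambda,B}$ (a scalar multiple of a monomial) with $x^\mu=b_\mu x^{\mathrm{corn}}$ for all $\mu\in\mathrm{corn}(\Lambda)$. The elements $x^\lambda$, $\lambda\in\Lambda\setminus\mathrm{corn}(\Lambda)$, together with $x^{\mathrm{corn}}$ form a basis of $A_{\Lambda,B}$; the coordinates of an element (and the homogeneous coordinates on $\mathbb{P}(A_{\Lambda,B})$) are denoted by $\sum_{\lambda\in\Lambda\setminus\mathrm{corn}(\Lambda)}z_\lambda x^\lambda+z_{\mathrm{corn}}x^{\mathrm{corn}}$, with $z_0=z_{(0,\ldots,0)}$, $z_i=z_{e_i}$ for $1\le i\le k$, and $z^\lambda=z_1^{\lambda_1}\cdots z_k^{\lambda_k}$. The algebra $A_{\Lambda,B}$ is local with maximal ideal $\mathfrak{m}=U_{\Lambda,B}\oplus\langle x^{\mathrm{corn}}\rangle$, and $\dim A_{\Lambda,B}=n+1$, where $n$ is the number of non-corner cells of $\Lambda$. An $H$-pair is a pair $(A,U)$ with $A$ a local finite-dimensional commutative associative unital algebra over $\mathbb{K}$ with maximal ideal $\mathfrak{m}$ and $U\subseteq\mathfrak{m}$ a hyperplane generating $A$ as a unital algebra; $(A_{\Lambda,B},U_{\Lambda,B})$ is an $H$-pair. The hypersurface corresponding to an $H$-pair $(A,U)$ is $X=p(\overline{\mathbb{K}^\times\exp U})\subseteq\mathbb{P}(A)$, $p\colon A\setminus\{0\}\to\mathbb{P}(A)$ being the canonical projection; it carries the induced additive action of $\exp U\cong\mathbb{G}_a^{n-1}$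 by multiplication (an effective action of the vector group with an open orbit, extending to $\mathbb{P}(A)$). It is known that $X$ is irreducible, its degree $d$ is the greatest integer with $\mathfrak{m}^d\nsubseteq U$, and its equation is $z_0^d\pi(\ln(1+z/z_0))=0$ for $z_0+z\in\mathbb{K}\oplus\mathfrak{m}=A$, where $\pi\colon\mathfrak{m}\to\mathfrak{m}/U\cong\mathbb{K}$ is the projection; for $(A_{\Lambda,B},U_{\Lambda,B})$, $\pi(z)$ is taken to be the coordinate $z_{\mathrm{corn}}$ of $z$.
   Formalization: For d = 2 the last double sum involves z_ν with ν a corner cell, which is not a defined coordinate; there that double sum is replaced by z_corn, giving f_1 = z_corn. For d ≥ 3 the formula is as stated. *)

theory Defs
  imports
    "HOL-Library.Poly_Mapping"
    "HOL-Computational_Algebra.Polynomial"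
    "HOL-Algebra.QuotRing"
    "HOL-Algebra.Module"
    "HOL-Algebra.Algebraic_Closure_Type"
begin

section \<open>Multivariate polynomials\<close>

text \<open>
  A monomial in variables of type \<open>'v\<close> is its finitely supported exponent vector, so the
  polynomial ring is the monoid algebra \<^typ>\<open>('v \<Rightarrow>\<^sub>0 nat) \<Rightarrow>\<^sub>0 'a\<close> with the library's convolution
  product. Subtraction of exponent vectors is pointwise (and truncated).
\<close>

type_synonym 'v expo = "'v \<Rightarrow>\<^sub>0 nat"
type_synonym ('v, 'a) mpoly = "'v expo \<Rightarrow>\<^sub>0 'a"

definition expo_deg :: "'v expo \<Rightarrow> nat"
  where "expo_deg m = (\<Sum>i\<in>Poly_Mapping.keys m. Poly_Mapping.lookup m i)"

definition monomial :: "'v expo \<Rightarrow> ('v, 'a::comm_ring_1) mpoly"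
  where "monomial m = Poly_Mapping.single m 1"

definition Const :: "'a::comm_ring_1 \<Rightarrow> ('v, 'a) mpoly"
  where "Const c = Poly_Mapping.single 0 c"

definition Var :: "'v \<Rightarrow> ('v, 'a::comm_ring_1) mpoly"
  where "Var i = monomial (Poly_Mapping.single i 1)"

definition mvars :: "('v, 'a::comm_ring_1) mpoly \<Rightarrow> 'v set"
  where "mvars p = (\<Union>m\<in>Poly_Mapping.keys p. Poly_Mapping.keys m)"

definition meval :: "('v \<Rightarrow> 'a) \<Rightarrow> ('v, 'a::comm_ring_1) mpoly \<Rightarrow> 'a"
  where "meval v p = (\<Sum>m\<in>Poly_Mapping.keys p.
    Poly_Mapping.lookup p m * (\<Prod>i\<in>Poly_Mapping.keys m. v i ^ Poly_Mapping.lookup m i))"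

definition homogeneous :: "nat \<Rightarrow> ('v, 'a::comm_ring_1) mpoly \<Rightarrow> bool"
  where "homogeneous d p \<longleftrightarrow> (\<forall>m\<in>Poly_Mapping.keys p. expo_deg m = d)"


section \<open>Exponential and logarithm in an algebra\<close>

text \<open>
  Both series are used for nilpotent arguments only; restricting the index set to the non-zero
  powers makes them finite sums.
\<close>

definition alg_exp :: "('a::field_char_0, 'e) module \<Rightarrow> 'e \<Rightarrow> 'e"
  where "alg_exp A u =
    (\<Oplus>\<^bsub>A\<^esub>n\<in>{n::nat. u [^]\<^bsub>A\<^esub> n \<noteq> \<zero>\<^bsub>A\<^esub>}. (1 / fact n) \<odot>\<^bsub>A\<^esub> (u [^]\<^bsub>A\<^esub> n))"

text \<open>\<open>alg_ln1p A w\<close> is \<open>ln (1 + w)\<close>.\<close>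

definition alg_ln1p :: "('a::field_char_0, 'e) module \<Rightarrow> 'e \<Rightarrow> 'e"
  where "alg_ln1p A w =
    (\<Oplus>\<^bsub>A\<^esub>n\<in>{n::nat. n \<ge> 1 \<and> w [^]\<^bsub>A\<^esub> n \<noteq> \<zero>\<^bsub>A\<^esub>}.
       ((- 1) ^ (n - 1) / of_nat n) \<odot>\<^bsub>A\<^esub> (w [^]\<^bsub>A\<^esub> n))"


section \<open>Hypersurfaces in the projectivization of an algebra\<close>

text \<open>
  Throughout, \<open>z\<close> maps an element of \<open>A\<close> to its coordinates with respect to a basis indexed by the
  set \<open>V\<close>. Polynomial functions on \<open>A\<close> are those given by polynomials in the variables from \<open>V\<close>.
  A point of the projective space is a punctured line.
\<close>

definition proj :: "('a::field, 'e) module \<Rightarrow> 'e \<Rightarrow> 'e set"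
  where "proj A a = {c \<odot>\<^bsub>A\<^esub> a | c. c \<noteq> 0}"

definition zariski_closure ::
  "('a::field, 'e) module \<Rightarrow> 'v set \<Rightarrow> ('e \<Rightarrow> 'v \<Rightarrow> 'a) \<Rightarrow> 'e set \<Rightarrow> 'e set"
  where "zariski_closure A V z S = {a \<in> carrier A.
    \<forall>F. mvars F \<subseteq> V \<longrightarrow> (\<forall>s\<in>S. meval (z s) F = 0) \<longrightarrow> meval (z a) F = 0}"

definition zero_locus ::
  "('a::field, 'e) module \<Rightarrow> ('e \<Rightarrow> 'v \<Rightarrow> 'a) \<Rightarrow> ('v, 'a) mpoly \<Rightarrow> 'e set set"
  where "zero_locus A z F = {proj A a | a. a \<in> carrier A \<and> a \<noteq> \<zero>\<^bsub>A\<^esub> \<and> meval (z a) F = 0}"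

text \<open>
  The degree of a hypersurface is the degree of a form that cuts it out and generates its
  homogeneous vanishing ideal.
\<close>

definition defining_form ::
  "('a::field, 'e) module \<Rightarrow> 'v set \<Rightarrow> ('e \<Rightarrow> 'v \<Rightarrow> 'a) \<Rightarrow> 'e set set \<Rightarrow> nat
     \<Rightarrow> ('v, 'a) mpoly \<Rightarrow> bool"
  where "defining_form A V z S d F \<longleftrightarrow>
    mvars F \<subseteq> V \<and> F \<noteq> 0 \<and> homogeneous d F \<and> S = zero_locus A z F \<and>
    (\<forall>e G. mvars G \<subseteq> V \<and> homogeneous e G \<longrightarrow>
       ((\<forall>a\<in>carrier A. a \<noteq> \<zero>\<^bsub>A\<^esub> \<and> proj A a \<in> S \<longrightarrow> meval (z a) G = 0) \<longleftrightarrow> F dvd G))"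

definition hypersurface_degree ::
  "('a::field, 'e) module \<Rightarrow> 'v set \<Rightarrow> ('e \<Rightarrow> 'v \<Rightarrow> 'a) \<Rightarrow> 'e set set \<Rightarrow> nat"
  where "hypersurface_degree A V z S = (THE d. \<exists>F. defining_form A V z S d F)"

definition hpair_hypersurface ::
  "('a::field_char_0, 'e) module \<Rightarrow> 'e set \<Rightarrow> 'v set \<Rightarrow> ('e \<Rightarrow> 'v \<Rightarrow> 'a) \<Rightarrow> 'e set set"
  where "hpair_hypersurface A U V z = proj A `
    (zariski_closure A V z {c \<odot>\<^bsub>A\<^esub> alg_exp A u | c u. c \<noteq> 0 \<and> u \<in> U} - {\<zero>\<^bsub>A\<^esub>})"


section \<open>Young diagrams\<close>

text \<open>The dimension is the cardinality of the finite type \<open>'k\<close>, hence positive.\<close>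

definition cell_le :: "'k expo \<Rightarrow> 'k expo \<Rightarrow> bool"  (infix \<open>\<preccurlyeq>\<close> 50)
  where "l \<preccurlyeq> m \<longleftrightarrow> (\<forall>i. Poly_Mapping.lookup l i \<le> Poly_Mapping.lookup m i)"

definition young_diagram :: "('k::finite) expo set \<Rightarrow> bool"
  where "young_diagram L \<longleftrightarrow> finite L \<and> (\<forall>m\<in>L. \<forall>l. l \<preccurlyeq> m \<longrightarrow> l \<in> L) \<and>
    (\<forall>i. \<exists>l\<in>L. Poly_Mapping.lookup l i \<noteq> 0)"

definition corn :: "'k expo set \<Rightarrow> 'k expo set"
  where "corn L = {m \<in> L. \<forall>l\<in>L. m \<preccurlyeq> l \<longrightarrow> l = m}"

definition unit_cell :: "'k \<Rightarrow> 'k expo"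
  where "unit_cell i = Poly_Mapping.single i 1"

definition exceptional_at :: "'k expo set \<Rightarrow> 'k \<Rightarrow> bool"
  where "exceptional_at L i \<longleftrightarrow> (\<forall>l\<in>L. Poly_Mapping.lookup l i = 0 \<or> l = unit_cell i)"

definition non_exceptional :: "'k expo set \<Rightarrow> bool"
  where "non_exceptional L \<longleftrightarrow> (\<forall>i. \<not> exceptional_at L i)"

definition multinom :: "('k::finite) expo \<Rightarrow> 'a::field_char_0"
  where "multinom m = fact (expo_deg m) / (\<Prod>i\<in>UNIV. fact (Poly_Mapping.lookup m i))"


section \<open>The H-pair of a Young diagram\<close>

text \<open>Only the values of \<open>b\<close> on the corner cells matter.\<close>

definition rel_ideal :: "'k expo set \<Rightarrow> ('k expo \<Rightarrow> 'a::field) \<Rightarrow> ('k, 'a) mpoly set"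
  where "rel_ideal L b = genideal ring_of_type_algebra
    ({monomial l | l. l \<notin> L} \<union>
     {Const (b n) * monomial m - Const (b m) * monomial n | m n. m \<in> corn L \<and> n \<in> corn L})"

text \<open>The residue class of a polynomial.\<close>

definition cls :: "'k expo set \<Rightarrow> ('k expo \<Rightarrow> 'a::field) \<Rightarrow> ('k, 'a) mpoly \<Rightarrow> ('k, 'a) mpoly set"
  where "cls L b p = rel_ideal L b +>\<^bsub>ring_of_type_algebra\<^esub> p"

definition A_alg ::
  "'k expo set \<Rightarrow> ('k expo \<Rightarrow> 'a::field) \<Rightarrow> ('a, ('k, 'a) mpoly set) module"
  where "A_alg L b = (let Q = ring_of_type_algebra Quot rel_ideal L b in
    \<lparr>carrier = carrier Q, monoid.mult = monoid.mult Q, one = one Q,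
     ring.zero = ring.zero Q, add = add Q,
     module.smult = (\<lambda>c a. cls L b (Const c) \<otimes>\<^bsub>Q\<^esub> a)\<rparr>)"

definition U_cells :: "'k expo set \<Rightarrow> 'k expo set"
  where "U_cells L = L - (corn L \<union> {0})"

definition U_space :: "'k expo set \<Rightarrow> ('k expo \<Rightarrow> 'a::field) \<Rightarrow> ('k, 'a) mpoly set set"
  where "U_space L b =
    {\<Oplus>\<^bsub>A_alg L b\<^esub>l\<in>U_cells L. c l \<odot>\<^bsub>A_alg L b\<^esub> cls L b (monomial l) | c. True}"

definition x_corn :: "'k expo set \<Rightarrow> ('k expo \<Rightarrow> 'a::field) \<Rightarrow> ('k, 'a) mpoly set"
  where "x_corn L b = (THE e. e \<in> carrier (A_alg L b) \<and>
    (\<forall>m\<in>corn L. cls L b (monomial m) = b m \<odot>\<^bsub>A_alg L b\<^esub> e))"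

text \<open>Index type of the coordinates \<open>z\<^sub>\<lambda>\<close> (for non-corner cells \<open>\<lambda>\<close>) and \<open>z\<^sub>c\<^sub>o\<^sub>r\<^sub>n\<close>.\<close>

datatype 'k coord = Cell "'k expo" | Corner

definition coords :: "'k expo set \<Rightarrow> 'k coord set"
  where "coords L = insert Corner (Cell ` (L - corn L))"

primrec basis_elem ::
  "'k expo set \<Rightarrow> ('k expo \<Rightarrow> 'a::field) \<Rightarrow> 'k coord \<Rightarrow> ('k, 'a) mpoly set"
  where
    "basis_elem L b (Cell l) = cls L b (monomial l)"
  | "basis_elem L b Corner = x_corn L b"

definition coord_of ::
  "'k expo set \<Rightarrow> ('k expo \<Rightarrow> 'a::field) \<Rightarrow> ('k, 'a) mpoly set \<Rightarrow> 'k coord \<Rightarrow> 'a"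
  where "coord_of L b a = (THE c. (\<forall>j. j \<notin> coords L \<longrightarrow> c j = 0) \<and>
    a = (\<Oplus>\<^bsub>A_alg L b\<^esub>j\<in>coords L. c j \<odot>\<^bsub>A_alg L b\<^esub> basis_elem L b j))"

definition X_hyp :: "'k expo set \<Rightarrow> ('k expo \<Rightarrow> 'a::field_char_0) \<Rightarrow> ('k, 'a) mpoly set set set"
  where "X_hyp L b = hpair_hypersurface (A_alg L b) (U_space L b) (coords L) (coord_of L b)"

definition X_degree :: "'k expo set \<Rightarrow> ('k expo \<Rightarrow> 'a::field_char_0) \<Rightarrow> nat"
  where "X_degree L b = hypersurface_degree (A_alg L b) (coords L) (coord_of L b) (X_hyp L b)"

text \<open>
  The polynomial \<open>z\<^sub>0\<^sup>d \<pi>(ln (1 + z/z\<^sub>0))\<close>, as the polynomial in the coordinates of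
  \<open>a = z\<^sub>0 + z\<close> that takes these values wherever \<open>z\<^sub>0 \<noteq> 0\<close>.
\<close>

definition X_equation ::
  "'k expo set \<Rightarrow> ('k expo \<Rightarrow> 'a::field_char_0) \<Rightarrow> nat \<Rightarrow> ('k coord, 'a) mpoly"
  where "X_equation L b d = (THE f. mvars f \<subseteq> coords L \<and>
    (\<forall>a\<in>carrier (A_alg L b).
       let A = A_alg L b;
           z0 = coord_of L b a (Cell 0);
           z = a \<ominus>\<^bsub>A\<^esub> (z0 \<odot>\<^bsub>A\<^esub> \<one>\<^bsub>A\<^esub>)
       in z0 \<noteq> 0 \<longrightarrow>
          meval (coord_of L b a) f
            = z0 ^ d * coord_of L b (alg_ln1p A (inverse z0 \<odot>\<^bsub>A\<^esub> z)) Corner))"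

definition z0_decomposition ::
  "'k expo set \<Rightarrow> nat \<Rightarrow> ('k coord, 'a::field) mpoly \<Rightarrow> (nat \<Rightarrow> ('k coord, 'a) mpoly) \<Rightarrow> bool"
  where "z0_decomposition L d f fs \<longleftrightarrow>
    (\<forall>s\<in>{1..d}. homogeneous s (fs s) \<and> mvars (fs s) \<subseteq> coords L - {Cell 0}) \<and>
    f = (\<Sum>s=1..d. Var (Cell 0) ^ (d - s) * fs s)"

definition z_pow :: "('k::finite) expo \<Rightarrow> ('k coord, 'a::comm_ring_1) mpoly"
  where "z_pow l = (\<Prod>i\<in>UNIV. Var (Cell (unit_cell i)) ^ Poly_Mapping.lookup l i)"

text \<open>
  For \<open>d \<ge> 3\<close> every \<open>\<nu>\<close> occurring in this sum is a non-corner cell, so \<open>z\<^sub>\<nu>\<close> is a coordinate.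
  For \<open>d = 2\<close> the sum would read \<open>\<Sum> b\<^sub>\<mu> z\<^sub>\<mu>\<close> over corner cells \<open>\<mu>\<close>, for which no coordinate
  \<open>z\<^sub>\<mu>\<close> exists; since \<open>x\<^sup>\<mu> = b\<^sub>\<mu> x\<^sup>c\<^sup>o\<^sup>r\<^sup>n\<close>, it then denotes the coefficient of \<open>x\<^sup>c\<^sup>o\<^sup>r\<^sup>n\<close> in
  \<open>\<Sum> z\<^sub>\<mu> x\<^sup>\<mu>\<close>, that is, the coordinate \<open>z\<^sub>c\<^sub>o\<^sub>r\<^sub>n\<close>. This case has to be treated separately wherever
  the sum is used.
\<close>

definition quad_sum ::
  "('k::finite) expo set \<Rightarrow> ('k expo \<Rightarrow> 'a::field_char_0) \<Rightarrow> nat \<Rightarrow> ('k coord, 'a) mpoly"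
  where "quad_sum L b d =
    (\<Sum>m\<in>{m \<in> corn L. expo_deg m = d}. \<Sum>n\<in>{n. expo_deg n = 2 \<and> n \<preccurlyeq> m}.
       Const (multinom (m - n) * b m) * Var (Cell n) * z_pow (m - n))"

end

theory Submission
  imports Defs "HOL-Computational_Algebra.Polynomial_FPS"
begin

text \<open>
  A class \<open>z\<^sub>0 + z\<close> with \<open>z\<^sub>0 \<noteq> 0\<close> lies on the cone over \<open>exp U\<close> iff \<open>\<pi> (ln (1 + z / z\<^sub>0)) = 0\<close>, since
  exponential and logarithm are mutually inverse on nilpotent elements. Clearing denominators gives
  \<open>f\<close>, which stops at the largest \<open>d\<close> for which a monomial of degree \<open>d\<close> is a non-zero multiple of
  \<open>x\<^sup>c\<^sup>o\<^sup>r\<^sup>n\<close>. It has the form \<open>z\<^sub>0\<^sup>d\<^sup>-\<^sup>1 z\<^sub>c\<^sub>o\<^sub>r\<^sub>n + g\<close> with \<open>g\<close> free of \<open>z\<^sub>c\<^sub>o\<^sub>r\<^sub>n\<close>, so a polynomial \<open>G\<close> vanishing on the cone is,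
  up to a power of \<open>z\<^sub>0\<close>, a multiple of \<open>f\<close>; as \<open>f\<^sub>d \<noteq> 0\<close>, the variable \<open>z\<^sub>0\<close> does not divide \<open>f\<close> and
  \<open>f\<close> divides \<open>G\<close>. Hence \<open>f\<close> generates the ideal of the cone and \<open>d\<close> is the degree. The top two parts of
  \<open>f\<close> come from the products of degree-one cells, with at most one factor of degree two, that fill
  a corner.
\<close>

text \<open>The obstacle is the quotient: its elements are cosets, while everything to be proved
  concerns coordinates. The map \<open>co\<close> therefore reads coordinates off a polynomial
  representative, and \<open>rel_ideal_eq\<close> identifies the ideal with the kernel of
  \<open>co\<close>; after that, identities in the algebra are identities between values of
  \<open>co\<close>. Exponential and logarithm become truncated evaluations \<open>ser F p\<close>
  of formal power series, so that their being inverse is inherited from \<open>fps_exp 1\<close> and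
  \<open>fps_ln 1\<close>. Polynomials in the coordinates are compared by their values, which
  suffices in characteristic zero. Non-exceptionality enters through one fact: every corner has
  degree at least 2, so that 0 and the unit cells are non-corner cells. A product of two or more
  nilpotent factors never uses a corner coefficient, which confines \<open>z_corn\<close> to the
  linear term of the logarithm. The constants \<open>c_m\<close> count the ways of reaching the cell
  \<open>m\<close> by unit steps; in the second sum of \<open>f_(d-1)\<close> the denominator of the
  logarithm is cancelled by the \<open>d - 1\<close> positions of the one step of degree 2.\<close>

lemma single_sum_eq: "(\<Sum>m\<in>Poly_Mapping.keys p. Poly_Mapping.single m (Poly_Mapping.lookup p m)) = p"
  by (rule poly_mapping_eqI)
    (auto simp: lookup_sum lookup_single when_def sum.delta' in_keys_iff)

lemma single_conv_Const: "Poly_Mapping.single m c = Const c * monomial m"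
  by (simp add: Const_def monomial_def mult_single)

lemma monomial_0 [simp]: "monomial 0 = 1"
  by (simp add: monomial_def)

lemma monomial_add: "monomial (m + n) = monomial m * monomial n"
  by (simp add: monomial_def mult_single)

lemma monomial_single: "monomial (Poly_Mapping.single i n) = Var i ^ n"
proof (induction n)
  case (Suc n)
  have "Poly_Mapping.single i (Suc n) = Poly_Mapping.single i 1 + Poly_Mapping.single i n"
    by (simp flip: single_add)
  with Suc show ?case by (simp only: monomial_add Var_def power_Suc)
qed simp

lemma monomial_sum: "monomial (sum g I) = (\<Prod>i\<in>I. monomial (g i))"
  by (induction I rule: infinite_finite_induct) (simp_all add: monomial_add)

lemma monomial_conv_Var:
  "monomial m = (\<Prod>i\<in>Poly_Mapping.keys m. Var i ^ Poly_Mapping.lookup m i)"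
  by (metis (no_types, lifting) monomial_single monomial_sum prod.cong single_sum_eq)

lemma Const_0 [simp]: "Const 0 = 0"
  and Const_1 [simp]: "Const 1 = 1"
  and Const_add: "Const (c + d) = Const c + Const d"
  and Const_mult: "Const (c * d) = Const c * Const d"
  and Const_uminus: "Const (- c) = - Const c"
  and Const_diff: "Const (c - d) = Const c - Const d"
  by (simp_all add: Const_def single_add mult_single single_uminus single_diff)

lemma Const_sum: "Const (sum g I) = (\<Sum>i\<in>I. Const (g i))"
  by (induction I rule: infinite_finite_induct) (simp_all add: Const_add)

lemma Const_of_nat: "Const (of_nat n) = of_nat n"
  by (induction n) (simp_all add: Const_add)

lemma lookup_Const_mult: "Poly_Mapping.lookup (Const c * p) m = c * Poly_Mapping.lookup p m"
proof -
  have "Const c * p = (\<Sum>n\<in>Poly_Mapping.keys p. Poly_Mapping.single n (c * Poly_Mapping.lookup p n))"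
    by (subst (1) single_sum_eq[of p, symmetric])
      (simp add: sum_distrib_left Const_def mult_single)
  then show ?thesis
    by (auto simp: lookup_sum lookup_single when_def sum.delta' in_keys_iff)
qed

subsection \<open>Variables and degrees\<close>

lemma mvars_0 [simp]: "mvars 0 = {}"
  and mvars_1 [simp]: "mvars 1 = {}"
  and mvars_Const [simp]: "mvars (Const c) = {}"
  by (auto simp: mvars_def Const_def)

lemma mvars_Var [simp]: "mvars (Var i :: ('v, 'a::comm_ring_1) mpoly) = {i}"
  by (auto simp: mvars_def Var_def monomial_def)

lemma keys_expo_add:
  "Poly_Mapping.keys (m + n :: 'v expo) = Poly_Mapping.keys m \<union> Poly_Mapping.keys n"
  by (auto simp: in_keys_iff lookup_add)

lemma mvars_add: "mvars (p + q) \<subseteq> mvars p \<union> mvars q"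
  using keys_add[of p q] by (fastforce simp: mvars_def)

lemma mvars_mult: "mvars (p * q) \<subseteq> mvars p \<union> mvars q"
  using keys_mult[of p q] by (fastforce simp: mvars_def keys_expo_add)

lemma mvars_uminus [simp]: "mvars (- p) = mvars p"
  by (simp add: mvars_def in_keys_iff)

lemma mvars_sum: "mvars (sum g I) \<subseteq> (\<Union>i\<in>I. mvars (g i))"
proof (induction I rule: infinite_finite_induct)
  case (insert i I)
  then show ?case using mvars_add[of "g i" "sum g I"] by auto
qed simp_all

lemma mvars_power: "mvars (p ^ n) \<subseteq> mvars p"
proof (induction n)
  case (Suc n)
  then show ?case using mvars_mult[of p "p ^ n"] by auto
qed simp

lemma expo_deg_0 [simp]: "expo_deg 0 = 0"
  by (simp add: expo_deg_def)

lemma expo_deg_single [simp]: "expo_deg (Poly_Mapping.single i n) = n"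
  by (simp add: expo_deg_def)

lemma expo_deg_superset:
  assumes "finite S" "Poly_Mapping.keys m \<subseteq> S"
  shows "expo_deg m = (\<Sum>i\<in>S. Poly_Mapping.lookup m i)"
  unfolding expo_deg_def using assms
  by (intro sum.mono_neutral_left) (auto simp: in_keys_iff)

lemma expo_deg_add: "expo_deg (m + n) = expo_deg m + expo_deg n"
  by (simp add: expo_deg_superset[of "Poly_Mapping.keys m \<union> Poly_Mapping.keys n"]
      keys_expo_add lookup_add sum.distrib)

lemma expo_deg_eq_0_iff [simp]: "expo_deg m = 0 \<longleftrightarrow> m = 0"
proof
  assume "expo_deg m = 0"
  then show "m = 0"
    by (intro poly_mapping_eqI) (auto simp: expo_deg_def in_keys_iff)
qed simp

lemma homogeneous_0 [simp]: "homogeneous d 0"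
  and homogeneous_1 [simp]: "homogeneous 0 1"
  by (simp_all add: homogeneous_def)

lemma homogeneous_Const [simp]: "homogeneous 0 (Const c)"
  by (simp add: homogeneous_def Const_def)

lemma homogeneous_Var [simp]: "homogeneous 1 (Var i)"
  by (simp add: homogeneous_def Var_def monomial_def)

lemma homogeneous_add: "homogeneous d p \<Longrightarrow> homogeneous d q \<Longrightarrow> homogeneous d (p + q)"
  using keys_add[of p q] by (auto simp: homogeneous_def)

lemma homogeneous_sum: "(\<And>i. i \<in> I \<Longrightarrow> homogeneous d (g i)) \<Longrightarrow> homogeneous d (sum g I)"
  by (induction I rule: infinite_finite_induct) (simp_all add: homogeneous_add)

lemma homogeneous_mult: "homogeneous d p \<Longrightarrow> homogeneous e q \<Longrightarrow> homogeneous (d + e) (p * q)"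
  using keys_mult[of p q] by (fastforce simp: homogeneous_def expo_deg_add)

lemma homogeneous_Const_mult: "homogeneous d p \<Longrightarrow> homogeneous d (Const c * p)"
  using homogeneous_mult[OF homogeneous_Const] by fastforce

lemma homogeneous_Var_power: "homogeneous n (Var i ^ n)"
  by (simp add: homogeneous_def monomial_def flip: monomial_single)

text \<open>Every monomial of \<open>p\<close> is a monomial of \<open>q\<close> times another one.
  Applied in both directions, this compares the degrees of two defining forms.\<close>

lemma homogeneous_dvd_degree_le:
  assumes "homogeneous d p" "homogeneous e q" "p \<noteq> 0" "q dvd p"
  shows "e \<le> d"
proof -
  obtain r where r: "p = q * r" using assms by auto
  obtain m where m: "m \<in> Poly_Mapping.keys p" using \<open>p \<noteq> 0\<close> by fastforce
  then obtain a c where "a \<in> Poly_Mapping.keys q" "m = a + c"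
    using keys_mult[of q r] r by blast
  then show ?thesis using assms m by (auto simp: homogeneous_def expo_deg_add)
qed

text \<open>Makes pseudo-division by the equation and reduction modulo a variable provable on
  generators; the set \<open>V\<close> keeps track of the variables allowed.\<close>

lemma mpoly_induct [consumes 1, case_names Const Var add mult]:
  fixes p :: "('v, 'a::comm_ring_1) mpoly"
  assumes "mvars p \<subseteq> V"
    and C: "\<And>c. P (Const c)" and V: "\<And>i. i \<in> V \<Longrightarrow> P (Var i)"
    and A: "\<And>p q. P p \<Longrightarrow> P q \<Longrightarrow> P (p + q)" and M: "\<And>p q. P p \<Longrightarrow> P q \<Longrightarrow> P (p * q)"
  shows "P p"
proof -
  have pow: "P (Var i ^ n)" if "i \<in> V" for i n
    using C[of 1] by (induction n) (auto intro: M V that)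
  have prod: "P (\<Prod>i\<in>S. Var i ^ e i)" if "S \<subseteq> V" for S e
    using that C[of 1] by (induction S rule: infinite_finite_induct) (auto intro: M pow)
  have "P (\<Sum>m\<in>S. Poly_Mapping.single m (Poly_Mapping.lookup p m))"
    if "S \<subseteq> Poly_Mapping.keys p" for S
    using finite_subset[OF that finite_keys] that
  proof (induction S rule: finite_induct)
    case (insert m S)
    have "P (Poly_Mapping.single m (Poly_Mapping.lookup p m))"
      unfolding single_conv_Const monomial_conv_Var using assms(1) insert.prems
      by (intro M C prod) (auto simp: mvars_def)
    then show ?case using insert by (auto intro: A)
  qed (use C[of 0] in simp)
  then show ?thesis by (metis single_sum_eq subset_refl)
qed

subsection \<open>Substitution\<close>

definition expo_val :: "('v \<Rightarrow> 'b::comm_ring_1) \<Rightarrow> 'v expo \<Rightarrow> 'b"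
  where "expo_val v m = (\<Prod>i\<in>Poly_Mapping.keys m. v i ^ Poly_Mapping.lookup m i)"

text \<open>The map on coefficients is a parameter because three substitutions occur: the identity
  gives evaluation, \<open>Const\<close> gives substitution of polynomials, and constant polynomials
  give the passage to one variable.\<close>

definition msubst :: "('a::comm_ring_1 \<Rightarrow> 'b::comm_ring_1) \<Rightarrow> ('v \<Rightarrow> 'b) \<Rightarrow> ('v, 'a) mpoly \<Rightarrow> 'b"
  where "msubst \<phi> v p = (\<Sum>m\<in>Poly_Mapping.keys p. \<phi> (Poly_Mapping.lookup p m) * expo_val v m)"

lemma meval_conv_msubst: "meval v = msubst (\<lambda>c. c) v"
  by (simp add: fun_eq_iff meval_def msubst_def expo_val_def)

lemma expo_val_superset:
  "finite S \<Longrightarrow> Poly_Mapping.keys m \<subseteq> S \<Longrightarrow> expo_val v m = (\<Prod>i\<in>S. v i ^ Poly_Mapping.lookup m i)"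
  unfolding expo_val_def by (intro prod.mono_neutral_left) (auto simp: in_keys_iff)

lemma expo_val_0 [simp]: "expo_val v 0 = 1"
  by (simp add: expo_val_def)

lemma expo_val_add: "expo_val v (m + n) = expo_val v m * expo_val v n"
  by (simp add: expo_val_superset[of "Poly_Mapping.keys m \<union> Poly_Mapping.keys n"]
      keys_expo_add lookup_add power_add prod.distrib)

locale coeff_hom =
  fixes \<phi> :: "'a::comm_ring_1 \<Rightarrow> 'b::comm_ring_1"
  assumes hom_add: "\<phi> (x + y) = \<phi> x + \<phi> y"
    and hom_mult: "\<phi> (x * y) = \<phi> x * \<phi> y"
    and hom_1: "\<phi> 1 = 1"
begin

lemma hom_0: "\<phi> 0 = 0"
  using hom_add[of 0 0] by simp

lemma msubst_superset:
  "finite S \<Longrightarrow> Poly_Mapping.keys p \<subseteq> S \<Longrightarrow>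
    msubst \<phi> v p = (\<Sum>m\<in>S. \<phi> (Poly_Mapping.lookup p m) * expo_val v m)"
  unfolding msubst_def by (intro sum.mono_neutral_left) (auto simp: in_keys_iff hom_0)

lemma msubst_0 [simp]: "msubst \<phi> v 0 = 0"
  by (simp add: msubst_def)

lemma msubst_single: "msubst \<phi> v (Poly_Mapping.single m c) = \<phi> c * expo_val v m"
  by (subst msubst_superset[of "{m}"]) auto

lemma msubst_Const [simp]: "msubst \<phi> v (Const c) = \<phi> c"
  by (simp add: Const_def msubst_single)

lemma msubst_1 [simp]: "msubst \<phi> v 1 = 1"
  using msubst_Const[of v 1] by (simp add: hom_1)

lemma msubst_Var [simp]: "msubst \<phi> v (Var i) = v i"
  by (simp add: Var_def monomial_def msubst_single hom_1 expo_val_def)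

lemma msubst_add [simp]: "msubst \<phi> v (p + q) = msubst \<phi> v p + msubst \<phi> v q"
  using keys_add[of p q]
  by (simp add: msubst_superset[of "Poly_Mapping.keys p \<union> Poly_Mapping.keys q"]
      lookup_add hom_add sum.distrib distrib_right)

lemma msubst_sum [simp]: "msubst \<phi> v (sum g I) = (\<Sum>i\<in>I. msubst \<phi> v (g i))"
  by (induction I rule: infinite_finite_induct) simp_all

lemma msubst_mult [simp]: "msubst \<phi> v (p * q) = msubst \<phi> v p * msubst \<phi> v q"
proof -
  have "p * q = (\<Sum>m\<in>Poly_Mapping.keys p. \<Sum>n\<in>Poly_Mapping.keys q.
      Poly_Mapping.single (m + n) (Poly_Mapping.lookup p m * Poly_Mapping.lookup q n))"
    by (subst (1) single_sum_eq[of p, symmetric], subst (1) single_sum_eq[of q, symmetric])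
      (simp add: sum_product mult_single)
  also have "msubst \<phi> v \<dots> = msubst \<phi> v p * msubst \<phi> v q"
    by (simp add: msubst_def[of _ _ p] msubst_def[of _ _ q] msubst_single sum_product
        hom_mult expo_val_add mult_ac)
  finally show ?thesis .
qed

lemma msubst_uminus [simp]: "msubst \<phi> v (- p) = - msubst \<phi> v p"
  using msubst_add[of v p "- p"] by (simp add: minus_unique del: msubst_add)

lemma msubst_diff [simp]: "msubst \<phi> v (p - q) = msubst \<phi> v p - msubst \<phi> v q"
  using msubst_add[of v p "- q"] by simp

lemma msubst_power [simp]: "msubst \<phi> v (p ^ n) = msubst \<phi> v p ^ n"
  by (induction n) simp_all

lemma msubst_prod [simp]: "msubst \<phi> v (prod g I) = (\<Prod>i\<in>I. msubst \<phi> v (g i))"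
  by (induction I rule: infinite_finite_induct) simp_all

end

lemma msubst_cong:
  assumes "\<And>i. i \<in> mvars p \<Longrightarrow> v i = w i"
  shows "msubst \<phi> v p = msubst \<phi> w p"
proof -
  have "v i = w i" if "m \<in> Poly_Mapping.keys p" "i \<in> Poly_Mapping.keys m" for m i
    using assms that by (auto simp: mvars_def)
  then show ?thesis
    unfolding msubst_def expo_val_def
    by (intro sum.cong refl arg_cong2[where f = "(*)"] prod.cong) simp
qed

global_interpretation id_hom: coeff_hom "\<lambda>c::'a::comm_ring_1. c"
  by standard simp_all

global_interpretation Const_hom: coeff_hom "Const :: 'a::comm_ring_1 \<Rightarrow> ('v, 'a) mpoly"
  by standard (simp_all add: Const_add Const_mult)

global_interpretation poly_hom: coeff_hom "\<lambda>c::'a::comm_ring_1. [:c:]"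
  by standard simp_all

lemmas meval_cong = msubst_cong[where \<phi> = "\<lambda>c. c", folded meval_conv_msubst]

lemmas meval_simps [simp] =
  id_hom.msubst_0[folded meval_conv_msubst]
  id_hom.msubst_1[folded meval_conv_msubst]
  id_hom.msubst_Const[folded meval_conv_msubst]
  id_hom.msubst_Var[folded meval_conv_msubst]
  id_hom.msubst_add[folded meval_conv_msubst]
  id_hom.msubst_sum[folded meval_conv_msubst]
  id_hom.msubst_mult[folded meval_conv_msubst]
  id_hom.msubst_uminus[folded meval_conv_msubst]
  id_hom.msubst_diff[folded meval_conv_msubst]
  id_hom.msubst_power[folded meval_conv_msubst]
  id_hom.msubst_prod[folded meval_conv_msubst]

lemma meval_homogeneous:
  fixes p :: "('v, 'a::comm_ring_1) mpoly"
  assumes "homogeneous d p"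
  shows "meval (\<lambda>i. t * v i) p = t ^ d * meval v p"
proof -
  have "expo_val (\<lambda>i. t * v i) m = t ^ expo_deg m * expo_val v m" for m :: "'v expo"
    by (simp add: expo_val_def expo_deg_def power_mult_distrib prod.distrib power_sum)
  then show ?thesis using assms
    by (simp add: meval_conv_msubst msubst_def homogeneous_def sum_distrib_left mult_ac)
qed

text \<open>Kronecker substitution: suitable powers of one variable separate finitely many monomials,
  which reduces statements about polynomials to the univariate case.\<close>

lemma Kronecker_weights:
  fixes V :: "'v set"
  assumes "finite V" "N > 0"
  shows "\<exists>w::'v \<Rightarrow> nat. \<forall>m n. (\<forall>i\<in>V. m i < N \<and> n i < N) \<longrightarrow>
    (\<Sum>i\<in>V. w i * m i) = (\<Sum>i\<in>V. w i * n i) \<longrightarrow> (\<forall>i\<in>V. m i = n i)"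
  using assms(1)
proof (induction V rule: finite_induct)
  case (insert x V)
  then obtain w :: "'v \<Rightarrow> nat" where w: "\<And>m n. (\<forall>i\<in>V. m i < N \<and> n i < N) \<Longrightarrow>
    (\<Sum>i\<in>V. w i * m i) = (\<Sum>i\<in>V. w i * n i) \<Longrightarrow> (\<forall>i\<in>V. m i = n i)" by blast
  \<comment> \<open>Positional notation in base \<open>N\<close>: the new variable takes the lowest
    digit, which reduction modulo \<open>N\<close> recovers.\<close>
  define w' where "w' i = (if i = x then 1 else N * w i)" for i
  have w': "(\<Sum>i\<in>insert x V. w' i * m i) = m x + N * (\<Sum>i\<in>V. w i * m i)" for m
  proof -
    have "(\<Sum>i\<in>V. w' i * m i) = (\<Sum>i\<in>V. N * (w i * m i))"
      using insert.hyps by (intro sum.cong) (auto simp: w'_def)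
    then show ?thesis using insert.hyps by (simp add: w'_def sum_distrib_left)
  qed
  show ?case
  proof (intro exI[of _ w'] allI impI)
    fix m n :: "'v \<Rightarrow> nat"
    assume lt: "\<forall>i\<in>insert x V. m i < N \<and> n i < N"
      and eq: "(\<Sum>i\<in>insert x V. w' i * m i) = (\<Sum>i\<in>insert x V. w' i * n i)"
    have *: "m x + N * (\<Sum>i\<in>V. w i * m i) = n x + N * (\<Sum>i\<in>V. w i * n i)"
      using eq unfolding w' .
    have "m x = n x"
      using arg_cong[OF *, of "\<lambda>t. t mod N"] lt by simp
    moreover have "\<forall>i\<in>V. m i = n i"
      using w[of m n] lt * \<open>N > 0\<close> \<open>m x = n x\<close> by simp
    ultimately show "\<forall>i\<in>insert x V. m i = n i" by simp
  qed
qed simp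

text \<open>Once \<open>N\<close> exceeds every exponent that occurs, distinct monomials get
  distinct weights, so no coefficients are merged. A set of polynomials is treated at once because a
  product needs one substitution for both factors.\<close>

lemma Kronecker_substitution:
  fixes P :: "('v, 'a::comm_ring_1) mpoly set"
  assumes "finite P" "0 \<notin> P"
  shows "\<exists>w. \<forall>p\<in>P. msubst (\<lambda>c. [:c:]) (\<lambda>i. monom 1 (w i)) p \<noteq> 0"
proof -
  define M where "M = (\<Union>p\<in>P. Poly_Mapping.keys p)"
  define V where "V = (\<Union>m\<in>M. Poly_Mapping.keys m)"
  \<comment> \<open>The element 0 is inserted so that \<open>Max\<close> is applied to a non-empty
    set even if only constants occur.\<close>
  define N where "N = Suc (Max (insert 0 (\<Union>m\<in>M. Poly_Mapping.lookup m ` V)))"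
  have fin: "finite M" "finite V" using assms by (auto simp: M_def V_def)
  have N: "Poly_Mapping.lookup m i < N" if "m \<in> M" "i \<in> V" for m i
    using that fin by (auto simp: N_def less_Suc_eq_le intro!: Max_ge)
  obtain w :: "'v \<Rightarrow> nat" where w: "\<And>m n. (\<forall>i\<in>V. m i < N \<and> n i < N) \<Longrightarrow>
    (\<Sum>i\<in>V. w i * m i) = (\<Sum>i\<in>V. w i * n i) \<Longrightarrow> (\<forall>i\<in>V. m i = n i)"
    using Kronecker_weights[OF fin(2), of N] by (auto simp: N_def)
  define wt where "wt m = (\<Sum>i\<in>V. w i * Poly_Mapping.lookup m i)" for m
  have inj: "m = n" if "m \<in> M" "n \<in> M" "wt m = wt n" for m n
  proof (rule poly_mapping_eqI)
    fix i
    have "\<forall>i\<in>V. Poly_Mapping.lookup m i = Poly_Mapping.lookup n i"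
      using w[of "Poly_Mapping.lookup m" "Poly_Mapping.lookup n"] that N by (auto simp: wt_def)
    moreover have "Poly_Mapping.lookup m i = 0 \<and> Poly_Mapping.lookup n i = 0" if "i \<notin> V"
      using that \<open>m \<in> M\<close> \<open>n \<in> M\<close> by (auto simp: V_def in_keys_iff)
    ultimately show "Poly_Mapping.lookup m i = Poly_Mapping.lookup n i" by (cases "i \<in> V") auto
  qed
  have val: "expo_val (\<lambda>i. monom 1 (w i)) m = (monom 1 (wt m) :: 'a poly)" if "m \<in> M" for m
  proof -
    have "(\<Prod>i\<in>S. monom 1 (e i) :: 'a poly) = monom 1 (\<Sum>i\<in>S. e i)" for S and e :: "'v \<Rightarrow> nat"
      by (induction S rule: infinite_finite_induct) (simp_all add: mult_monom)
    then show ?thesis using that fin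
      by (subst expo_val_superset[of V]) (auto simp: V_def wt_def monom_power mult.commute)
  qed
  show ?thesis
  proof (intro exI[of _ w] ballI)
    fix p assume p: "p \<in> P"
    then obtain m where m: "m \<in> Poly_Mapping.keys p" using assms by fastforce
    have "coeff (msubst (\<lambda>c. [:c:]) (\<lambda>i. monom 1 (w i)) p) (wt m)
        = (\<Sum>n\<in>Poly_Mapping.keys p. if n = m then Poly_Mapping.lookup p n else 0)"
      unfolding msubst_def coeff_sum
    proof (intro sum.cong refl)
      fix n assume "n \<in> Poly_Mapping.keys p"
      then have "n \<in> M" "m \<in> M" using p m by (auto simp: M_def)
      then show "coeff ([:Poly_Mapping.lookup p n:] * expo_val (\<lambda>i. monom 1 (w i)) n) (wt m)
          = (if n = m then Poly_Mapping.lookup p n else 0)"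
        using inj[of n m] by (auto simp: val)
    qed
    also have "\<dots> \<noteq> 0" using m by (simp add: in_keys_iff)
    finally show "msubst (\<lambda>c. [:c:]) (\<lambda>i. monom 1 (w i)) p \<noteq> 0" by auto
  qed
qed

text \<open>The Kronecker substitution is multiplicative and keeps both factors non-zero, and
  univariate polynomials over an integral domain form an integral domain.\<close>

lemma mpoly_no_zero_divisors:
  fixes p q :: "('v, 'a::idom) mpoly"
  assumes "p * q = 0"
  shows "p = 0 \<or> q = 0"
proof (rule ccontr)
  assume "\<not> ?thesis"
  then obtain w where "msubst (\<lambda>c. [:c:]) (\<lambda>i. monom 1 (w i)) p \<noteq> 0"
    "msubst (\<lambda>c. [:c:]) (\<lambda>i. monom 1 (w i)) q \<noteq> 0"
    using Kronecker_substitution[of "{p, q}"] by auto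
  then have "msubst (\<lambda>c. [:c:]) (\<lambda>i. monom 1 (w i)) (p * q) \<noteq> 0" by simp
  with assms show False by simp
qed

lemma mpoly_mult_left_cancel:
  fixes p q r :: "('v, 'a::idom) mpoly"
  assumes "p \<noteq> 0" "p * q = p * r"
  shows "q = r"
  using mpoly_no_zero_divisors[of p "q - r"] assms by (simp add: algebra_simps)

lemma Var_neq_0 [simp]: "(Var i :: ('v, 'a::comm_ring_1) mpoly) \<noteq> 0"
  by (metis empty_not_insert mvars_0 mvars_Var)

text \<open>The values of the Kronecker image are values of \<open>p\<close> at the points with
  coordinates \<open>t ^ w i\<close>, and a univariate polynomial vanishing on an infinite field is
  zero.\<close>

lemma meval_eq_0_imp_0:
  fixes p :: "('v, 'a::field_char_0) mpoly"
  assumes "\<And>v. meval v p = 0"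
  shows "p = 0"
proof (rule ccontr)
  assume "p \<noteq> 0"
  then obtain w where w: "msubst (\<lambda>c. [:c:]) (\<lambda>i. monom 1 (w i)) p \<noteq> 0" (is "?q \<noteq> 0")
    using Kronecker_substitution[of "{p}"] by auto
  have "poly ?q t = meval (\<lambda>i. t ^ w i) p" for t
    by (simp add: msubst_def meval_conv_msubst poly_sum expo_val_def poly_prod poly_monom)
  then show False using w assms poly_all_0_iff_0[of ?q] by simp
qed

lemma mpoly_eqI:
  fixes p q :: "('v, 'a::field_char_0) mpoly"
  assumes "\<And>v. meval v p = meval v q"
  shows "p = q"
  using meval_eq_0_imp_0[of "p - q"] assms by simp

text \<open>Setting \<open>x\<close> to 0 changes a polynomial only by a multiple of
  \<open>x\<close>.\<close>

lemma Var_dvd_if_subst_0: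
  fixes p :: "('v, 'a::comm_ring_1) mpoly"
  assumes "msubst Const (\<lambda>i. if i = x then 0 else Var i) p = 0"
  shows "Var x dvd p"
proof -
  let ?s = "msubst Const (\<lambda>i. if i = x then 0 else Var i) :: _ \<Rightarrow> ('v, 'a) mpoly"
  have "Var x dvd p - ?s p"
  proof (rule mpoly_induct[of p UNIV])
    fix p q assume *: "Var x dvd p - ?s p" "Var x dvd q - ?s q"
    show "Var x dvd (p + q) - ?s (p + q)"
      using dvd_add[OF *] by (simp add: algebra_simps)
    have "p * q - ?s (p * q) = (p - ?s p) * q + ?s p * (q - ?s q)" by (simp add: algebra_simps)
    then show "Var x dvd (p * q) - ?s (p * q)" using * by (simp only: dvd_add dvd_mult dvd_mult2)
  qed simp_all
  with assms show ?thesis by simp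
qed

subsection \<open>Cells\<close>

lemma cell_le_refl [simp]: "m \<preccurlyeq> m"
  by (simp add: cell_le_def)

lemma zero_cell_le [simp]: "0 \<preccurlyeq> m"
  by (simp add: cell_le_def)

lemma cell_le_trans: "l \<preccurlyeq> m \<Longrightarrow> m \<preccurlyeq> n \<Longrightarrow> l \<preccurlyeq> n"
  unfolding cell_le_def using order_trans by blast

lemma cell_le_add_diff: "l \<preccurlyeq> m \<Longrightarrow> l + (m - l) = m"
  by (rule poly_mapping_eqI) (simp add: cell_le_def lookup_add lookup_minus)

lemma cell_le_add [simp]: "l \<preccurlyeq> l + m"
  by (simp add: cell_le_def lookup_add)

lemma cell_diff_le [simp]: "m - l \<preccurlyeq> m"
  by (simp add: cell_le_def lookup_minus)

lemma expo_deg_cell_diff: "l \<preccurlyeq> m \<Longrightarrow> expo_deg (m - l) = expo_deg m - expo_deg l"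
  using expo_deg_add[of l "m - l"] by (simp add: cell_le_add_diff)

lemma expo_deg_mono: "l \<preccurlyeq> m \<Longrightarrow> expo_deg l \<le> expo_deg m"
  using expo_deg_add[of l "m - l"] by (simp add: cell_le_add_diff)

lemma cell_le_expo_deg_eq: "l \<preccurlyeq> m \<Longrightarrow> expo_deg l = expo_deg m \<Longrightarrow> l = m"
  using cell_le_add_diff[of l m] expo_deg_cell_diff[of l m]
  by (metis add.right_neutral diff_self_eq_0 expo_deg_eq_0_iff)

lemma expo_deg_eq_1_iff: "expo_deg l = 1 \<longleftrightarrow> (\<exists>i. l = unit_cell i)"
proof
  assume *: "expo_deg l = 1"
  then obtain i where i: "Poly_Mapping.lookup l i \<noteq> 0"
    by (metis expo_deg_eq_0_iff lookup_zero poly_mapping_eqI zero_neq_one)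
  then have "unit_cell i \<preccurlyeq> l"
    by (auto simp: cell_le_def unit_cell_def lookup_single when_def)
  then show "\<exists>i. l = unit_cell i"
    using * cell_le_expo_deg_eq[of "unit_cell i" l] by (auto simp: unit_cell_def)
qed (auto simp: unit_cell_def)

lemma inj_unit_cell: "inj_on unit_cell S"
  by (rule inj_onI) (metis keys_single one_neq_zero singleton_inject unit_cell_def)

lemma unit_cell_le_iff: "unit_cell i \<preccurlyeq> m \<longleftrightarrow> i \<in> Poly_Mapping.keys m"
  by (auto simp: cell_le_def unit_cell_def lookup_single when_def in_keys_iff)

lemma unit_cells_below: "{l. l \<preccurlyeq> m \<and> expo_deg l = 1} = unit_cell ` Poly_Mapping.keys m"
  by (auto simp: expo_deg_eq_1_iff[unfolded One_nat_def] unit_cell_le_iff)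

lemma finite_cells_below [simp]: "finite {l :: ('k::finite) expo. l \<preccurlyeq> m}"
proof (rule finite_imageD)
  have "Poly_Mapping.lookup ` {l. l \<preccurlyeq> m} \<subseteq> PiE UNIV (\<lambda>i. {..Poly_Mapping.lookup m i})"
    by (auto simp: cell_le_def)
  then show "finite (Poly_Mapping.lookup ` {l. l \<preccurlyeq> m})"
    by (rule finite_subset) (simp add: finite_PiE)
  show "inj_on Poly_Mapping.lookup {l. l \<preccurlyeq> m}"
    by (intro inj_onI poly_mapping_eqI) simp
qed

text \<open>Replaces the convolution by a finite sum over the cells below \<open>m\<close>, where
  the truncated difference \<open>m - l\<close> is the true complement of \<open>l\<close>.\<close>

lemma lookup_mult_cells:
  fixes p q :: "('k::finite, 'a::comm_ring_1) mpoly"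
  shows "Poly_Mapping.lookup (p * q) m =
    (\<Sum>l | l \<preccurlyeq> m. Poly_Mapping.lookup p l * Poly_Mapping.lookup q (m - l))"
proof -
  have "Sum_any (\<lambda>n. Poly_Mapping.lookup q n when m = l + n)
      = (if l \<preccurlyeq> m then Poly_Mapping.lookup q (m - l) else 0)" for l
  proof (cases "l \<preccurlyeq> m")
    case True
    then have "m = l + n \<longleftrightarrow> n = m - l" for n
      using cell_le_add_diff[of l m] by auto
    with True show ?thesis by simp
  next
    case False
    then have "m \<noteq> l + n" for n by auto
    with False show ?thesis by simp
  qed
  then have "Poly_Mapping.lookup (p * q) m = Sum_any (\<lambda>l. Poly_Mapping.lookup p l *
      (if l \<preccurlyeq> m then Poly_Mapping.lookup q (m - l) else 0))"
    by (simp add: lookup_mult)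
  also have "\<dots> = (\<Sum>l | l \<preccurlyeq> m. Poly_Mapping.lookup p l *
      (if l \<preccurlyeq> m then Poly_Mapping.lookup q (m - l) else 0))"
    by (rule Sum_any.expand_superset) (auto split: if_splits)
  finally show ?thesis by simp
qed

text \<open>Order of vanishing at the origin: each of the \<open>n\<close> factors contributes
  degree at least 1.\<close>

lemma lookup_power_eq_0:
  fixes p :: "('k::finite, 'a::comm_ring_1) mpoly"
  assumes "Poly_Mapping.lookup p 0 = 0" "expo_deg m < n"
  shows "Poly_Mapping.lookup (p ^ n) m = 0"
  using assms(2)
proof (induction n arbitrary: m)
  case (Suc n)
  have "Poly_Mapping.lookup p l * Poly_Mapping.lookup (p ^ n) (m - l) = 0" if "l \<preccurlyeq> m" for l
  proof (cases "l = 0")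
    case False
    then have "expo_deg l > 0" by (metis bot_nat_0.not_eq_extremum expo_deg_eq_0_iff)
    then have "Poly_Mapping.lookup (p ^ n) (m - l) = 0"
      using Suc that expo_deg_mono[OF that] by (intro Suc.IH) (simp add: expo_deg_cell_diff)
    then show ?thesis by simp
  qed (simp add: assms(1))
  then show ?case by (simp add: lookup_mult_cells)
qed simp

subsection \<open>The algebra of a Young diagram\<close>

lemma type_algebra_simps:
  "carrier ring_of_type_algebra = UNIV"
  "x \<otimes>\<^bsub>ring_of_type_algebra\<^esub> y = x * y"
  "x \<oplus>\<^bsub>ring_of_type_algebra\<^esub> y = x + y"
  "\<one>\<^bsub>ring_of_type_algebra\<^esub> = 1"
  "\<zero>\<^bsub>ring_of_type_algebra\<^esub> = 0"
  by (simp_all add: ring_of_type_algebra_def)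

lemma minus_type_algebra:
  "a_inv (ring_of_type_algebra :: 'a::comm_ring_1 ring) x = - x"
proof -
  interpret cring "ring_of_type_algebra :: 'a ring" by (rule comm_ring_1_class.cring_from_type_algebra)
  show ?thesis by (rule minus_equality) (simp_all add: type_algebra_simps)
qed

locale young_pair =
  fixes L :: "('k::finite) expo set" and b :: "'k expo \<Rightarrow> 'a::field_char_0"
  assumes young: "young_diagram L"
    and nonexceptional: "non_exceptional L"
    and b_nonzero: "\<exists>m\<in>corn L. b m \<noteq> 0"
begin

lemma finite_L [simp]: "finite L"
  using young by (simp add: young_diagram_def)

lemma in_L_if_le: "m \<in> L \<Longrightarrow> l \<preccurlyeq> m \<Longrightarrow> l \<in> L"
  using young by (auto simp: young_diagram_def)

lemma corn_in_L: "m \<in> corn L \<Longrightarrow> m \<in> L"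
  by (simp add: corn_def)

lemma finite_corn [simp]: "finite (corn L)"
  by (rule finite_subset[OF _ finite_L]) (auto simp: corn_def)

lemma noncorner_if_less: "m \<in> L \<Longrightarrow> l \<preccurlyeq> m \<Longrightarrow> l \<noteq> m \<Longrightarrow> l \<in> L - corn L"
  using in_L_if_le by (auto simp: corn_def)

text \<open>If 0 were maximal, \<open>L\<close> would contain nothing else. If a unit cell were
  maximal, every cell meeting that coordinate would lie above it and hence equal it, so
  \<open>L\<close> would be exceptional there.\<close>

lemma corn_deg_ge_2:
  assumes m: "m \<in> corn L"
  shows "2 \<le> expo_deg m"
proof (rule ccontr)
  assume "\<not> ?thesis"
  then consider "m = 0" | "expo_deg m = 1"
    by (metis One_nat_def expo_deg_eq_0_iff less_2_cases not_le)
  then show False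
  proof cases
    case 1
    obtain l where "l \<in> L" "l \<noteq> 0"
      using young unfolding young_diagram_def by (metis lookup_zero)
    then show False using m 1 by (auto simp: corn_def)
  next
    case 2
    then obtain i where mi: "unit_cell i = m" using expo_deg_eq_1_iff by metis
    have "l = unit_cell i" if "l \<in> L" "Poly_Mapping.lookup l i \<noteq> 0" for l
    proof -
      have "m \<preccurlyeq> l"
        using that by (auto simp: mi[symmetric] cell_le_def unit_cell_def lookup_single when_def)
      then show ?thesis using m that mi by (auto simp: corn_def)
    qed
    then have "exceptional_at L i" by (auto simp: exceptional_at_def)
    then show False using nonexceptional by (simp add: non_exceptional_def)
  qed
qed

lemma zero_noncorner: "0 \<in> L - corn L"
proof -
  obtain m where m: "m \<in> corn L" using b_nonzero by blast
  then have "m \<noteq> 0" using corn_deg_ge_2 by fastforce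
  then show ?thesis using noncorner_if_less[OF corn_in_L[OF m]] by simp
qed

lemma finite_coords [simp]: "finite (coords L)"
  by (simp add: coords_def)

text \<open>The coordinates of the residue class of \<open>p\<close>, computed on the
  representative: a corner monomial counts as \<open>b m\<close> times \<open>x^corn\<close>, and
  cells outside \<open>L\<close> count as zero. That this descends to the quotient is
  \<open>rel_ideal_eq\<close>.\<close>

definition co :: "('k, 'a) mpoly \<Rightarrow> 'k coord \<Rightarrow> 'a"
  where "co p j = (case j of Cell l \<Rightarrow> if l \<in> L - corn L then Poly_Mapping.lookup p l else 0
    | Corner \<Rightarrow> \<Sum>m\<in>corn L. b m * Poly_Mapping.lookup p m)"

lemma co_Cell: "l \<in> L - corn L \<Longrightarrow> co p (Cell l) = Poly_Mapping.lookup p l"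
  by (simp add: co_def)

lemma co_Corner: "co p Corner = (\<Sum>m\<in>corn L. b m * Poly_Mapping.lookup p m)"
  by (simp add: co_def)

lemma co_Cell_0: "co p (Cell 0) = Poly_Mapping.lookup p 0"
  using zero_noncorner by (simp add: co_Cell)

lemma co_outside: "j \<notin> coords L \<Longrightarrow> co p j = 0"
  by (auto simp: co_def coords_def split: coord.splits)

lemma co_add: "co (p + q) j = co p j + co q j"
  by (simp add: co_def lookup_add distrib_left sum.distrib split: coord.splits)

lemma co_0 [simp]: "co 0 j = 0"
  by (simp add: co_def split: coord.splits)

lemma co_Const_mult: "co (Const c * p) j = c * co p j"
  by (simp add: co_def lookup_Const_mult sum_distrib_left mult.left_commute split: coord.splits)

lemma co_monomial:
  "co (monomial l) j = (case j of Cell m \<Rightarrow> if l = m \<and> m \<in> L - corn L then 1 else 0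
    | Corner \<Rightarrow> if l \<in> corn L then b l else 0)"
proof (cases j)
  case Corner
  have "co (monomial l) Corner = (\<Sum>m\<in>corn L. if m = l then b m else 0)"
    unfolding co_Corner by (intro sum.cong) (auto simp: monomial_def lookup_single when_def)
  then show ?thesis by (simp add: Corner)
qed (auto simp: co_def monomial_def lookup_single when_def)

lemma co_uminus: "co (- p) j = - co p j"
  using co_Const_mult[of "-1"] by (simp add: Const_uminus)

lemma co_diff: "co (p - q) j = co p j - co q j"
  using co_add[of p "- q"] by (simp add: co_uminus)

lemma co_sum: "co (sum g I) j = (\<Sum>i\<in>I. co (g i) j)"
  by (induction I rule: infinite_finite_induct) (simp_all add: co_add)

text \<open>This makes the kernel of \<open>co\<close> an ideal. Cells strictly below a cell of
  \<open>L\<close> are non-corner cells, where \<open>p\<close> has coefficient 0. So non-corner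
  coefficients of \<open>p * q\<close> vanish, and the \<open>Corner\<close> coordinate of
  \<open>p\<close> is merely multiplied by the constant term of \<open>q\<close>.\<close>

lemma co_mult_eq_0:
  assumes "\<And>j. co p j = 0"
  shows "co (p * q) j = 0"
proof (cases "j \<in> coords L")
  case True
  have *: "Poly_Mapping.lookup p l = 0" if "l \<in> L - corn L" for l
    using assms[of "Cell l"] that by (simp add: co_def)
  show ?thesis
  proof (cases j)
    case (Cell l)
    then have l: "l \<in> L - corn L" using True by (auto simp: coords_def)
    have "Poly_Mapping.lookup p k = 0" if "k \<preccurlyeq> l" for k
      using l noncorner_if_less[of l k] that by (intro *) (cases "k = l"; auto)
    then show ?thesis using l by (simp add: Cell co_Cell lookup_mult_cells)
  next
    case Corner
    have "Poly_Mapping.lookup (p * q) m = Poly_Mapping.lookup q 0 * Poly_Mapping.lookup p m"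
      if m: "m \<in> corn L" for m
    proof -
      have "Poly_Mapping.lookup (p * q) m = (\<Sum>l | l \<preccurlyeq> m.
          if l = m then Poly_Mapping.lookup p m * Poly_Mapping.lookup q 0 else 0)"
        unfolding lookup_mult_cells
      proof (intro sum.cong refl)
        fix l assume "l \<in> {l. l \<preccurlyeq> m}"
        then have "l = m \<or> Poly_Mapping.lookup p l = 0"
          using noncorner_if_less[of m l] m * by (auto simp: corn_in_L)
        then show "Poly_Mapping.lookup p l * Poly_Mapping.lookup q (m - l)
            = (if l = m then Poly_Mapping.lookup p m * Poly_Mapping.lookup q 0 else 0)"
          by auto
      qed
      then show ?thesis by (simp add: sum.delta')
    qed
    then have "co (p * q) Corner = Poly_Mapping.lookup q 0 * co p Corner"
      by (simp add: co_Corner sum_distrib_left mult_ac)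
    then show ?thesis using assms Corner by simp
  qed
qed (rule co_outside)

text \<open>One inclusion holds because the generators lie in the kernel of \<open>co\<close>.
  Conversely, an element of the kernel has terms only outside \<open>L\<close>, which are multiples
  of generators, and at corners, which the corner relations collect at a single corner
  \<open>m0\<close>.\<close>

lemma rel_ideal_eq: "rel_ideal L b = {p. \<forall>j. co p j = 0}" (is "_ = ?J")
proof -
  define R where "R = (ring_of_type_algebra :: ('k, 'a) mpoly ring)"
  define G where "G = {monomial l | l. l \<notin> L} \<union>
     {Const (b n) * monomial m - Const (b m) * monomial n | m n. m \<in> corn L \<and> n \<in> corn L}"
  interpret R: cring R unfolding R_def by (rule comm_ring_1_class.cring_from_type_algebra)
  have R_simps: "carrier R = UNIV" "\<And>x y. x \<otimes>\<^bsub>R\<^esub> y = x * y" "\<And>x y. x \<oplus>\<^bsub>R\<^esub> y = x + y"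
    "\<zero>\<^bsub>R\<^esub> = 0" "\<And>x. a_inv R x = - x"
    by (simp_all add: R_def type_algebra_simps minus_type_algebra)
  have I: "rel_ideal L b = genideal R G"
    by (simp add: rel_ideal_def R_def G_def)
  have J: "ideal ?J R"
  proof (rule idealI)
    show "subgroup ?J (add_monoid R)"
      by (rule R.add.subgroupI)
        (auto simp: R_simps co_add co_uminus a_inv_def[symmetric] intro: exI[of _ 0])
  qed (auto simp: R_simps co_mult_eq_0 mult.commute[of _ "_ :: ('k, 'a) mpoly"] R.ring_axioms)
  have "G \<subseteq> ?J"
  proof
    fix p assume "p \<in> G"
    then consider l where "l \<notin> L" "p = monomial l"
      | m n where "m \<in> corn L" "n \<in> corn L" "p = Const (b n) * monomial m - Const (b m) * monomial n"
      by (auto simp: G_def)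
    then have "\<forall>j. co p j = 0"
      by cases (auto split: coord.splits simp: co_monomial co_diff co_Const_mult dest: corn_in_L)
    then show "p \<in> ?J" by simp
  qed
  then have 1: "rel_ideal L b \<subseteq> ?J"
    unfolding I by (rule R.genideal_minimal[OF J])
  interpret I: ideal "rel_ideal L b" R unfolding I by (rule R.genideal_ideal) (simp add: R_simps)
  have GI: "p \<in> rel_ideal L b" if "p \<in> G" for p
    using R.genideal_self[of G] that by (auto simp: I R_simps)
  have add: "p + q \<in> rel_ideal L b" if "p \<in> rel_ideal L b" "q \<in> rel_ideal L b" for p q
    using I.a_closed[OF that] by (simp add: R_simps)
  have zero: "0 \<in> rel_ideal L b" using I.zero_closed by (simp add: R_simps)
  have mult: "q * p \<in> rel_ideal L b" if "p \<in> rel_ideal L b" for p q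
    using I.I_l_closed[OF that, of q] by (simp add: R_simps)
  have sum: "sum g S \<in> rel_ideal L b" if "\<And>i. i \<in> S \<Longrightarrow> g i \<in> rel_ideal L b" for g :: "'k expo \<Rightarrow> _" and S
    using that by (induction S rule: infinite_finite_induct) (auto intro: add zero)
  obtain m0 where m0: "m0 \<in> corn L" "b m0 \<noteq> 0" using b_nonzero by blast
  have "?J \<subseteq> rel_ideal L b"
  proof
    fix p assume "p \<in> ?J"
    then have p: "co p j = 0" for j by simp
    have p0: "Poly_Mapping.lookup p l = 0" if "l \<in> L - corn L" for l
      using p[of "Cell l"] that by (simp add: co_def)
    let ?t = "\<lambda>m. Const (Poly_Mapping.lookup p m) * monomial m"
    let ?r = "\<lambda>m. Const (Poly_Mapping.lookup p m / b m0) *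
        (Const (b m0) * monomial m - Const (b m) * monomial m0)"
    \<comment> \<open>The relation \<open>?r m\<close> trades the monomial of \<open>m\<close> for a
      multiple of that of \<open>m0\<close>; the multiples add up to
      \<open>co p Corner / b m0\<close>, which is 0.\<close>
    have "?t m = ?r m + Const (b m * Poly_Mapping.lookup p m / b m0) * monomial m0" for m
    proof -
      let ?c = "Poly_Mapping.lookup p m / b m0"
      have "Const (Poly_Mapping.lookup p m) = (Const ?c * Const (b m0) :: ('k, 'a) mpoly)"
        "Const (b m * Poly_Mapping.lookup p m / b m0) = (Const ?c * Const (b m) :: ('k, 'a) mpoly)"
        using m0 by (simp_all add: mult.commute flip: Const_mult)
      then show ?thesis by (simp add: algebra_simps)
    qed
    then have "sum ?t (corn L)
        = sum ?r (corn L) + Const (co p Corner / b m0) * monomial m0"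
      by (simp add: sum.distrib co_Corner sum_divide_distrib Const_sum sum_distrib_right)
    also have "\<dots> = sum ?r (corn L)" by (simp add: p)
    also have "\<dots> \<in> rel_ideal L b"
      using m0 by (intro sum mult GI) (auto simp: G_def)
    finally have corners: "sum ?t (corn L) \<in> rel_ideal L b" .
    let ?K = "Poly_Mapping.keys p"
    have "p = sum ?t (?K \<union> corn L)"
      by (subst (1) single_sum_eq[symmetric], subst single_conv_Const, rule sum.mono_neutral_left)
        (auto simp: in_keys_iff)
    also have "\<dots> = sum ?t (corn L) + sum ?t (?K - corn L)"
      by (subst Un_commute, subst Un_Diff_cancel[symmetric], rule sum.union_disjoint) auto
    also have "\<dots> \<in> rel_ideal L b"
    proof (intro add corners sum mult GI)
      fix m assume "m \<in> ?K - corn L"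
      then have "m \<notin> L" using p0 by (auto simp: in_keys_iff)
      then show "monomial m \<in> G" by (auto simp: G_def)
    qed
    finally show "p \<in> rel_ideal L b" .
  qed
  with 1 show ?thesis by blast
qed

lemma cls_eq: "cls L b p = {q. co q = co p}"
proof -
  have "q \<in> cls L b p \<longleftrightarrow> (\<exists>r. (\<forall>j. co r j = 0) \<and> q = r + p)" for q
    by (auto simp: cls_def a_r_coset_def r_coset_def rel_ideal_eq type_algebra_simps)
  also have "\<dots> q \<longleftrightarrow> co q = co p" for q
    by (auto simp: fun_eq_iff co_add co_diff intro!: exI[of _ "q - p"])
  finally show ?thesis by blast
qed

text \<open>From here on the quotient is handled through representatives: equality in the algebra is
  equality of \<open>co\<close>.\<close>

lemma cls_eq_iff: "cls L b p = cls L b q \<longleftrightarrow> co p = co q"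
  by (auto simp: cls_eq)

abbreviation A where "A \<equiv> A_alg L b"

lemma A_ideal: "ideal (rel_ideal L b) (ring_of_type_algebra :: ('k, 'a) mpoly ring)"
proof -
  interpret R: cring "ring_of_type_algebra :: ('k, 'a) mpoly ring" by (rule comm_ring_1_class.cring_from_type_algebra)
  show ?thesis unfolding rel_ideal_def by (rule R.genideal_ideal) (simp add: type_algebra_simps)
qed

lemma carrier_A: "carrier A = range (cls L b)"
  by (auto simp: A_alg_def Let_def FactRing_def A_RCOSETS_def RCOSETS_def cls_def a_r_coset_def
      type_algebra_simps)

lemma cls_in_carrier [simp]: "cls L b p \<in> carrier A"
  by (simp add: carrier_A)

lemma mult_cls [simp]: "cls L b p \<otimes>\<^bsub>A\<^esub> cls L b q = cls L b (p * q)"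
  using ideal.rcoset_mult_add[OF A_ideal, of p q]
  by (simp add: A_alg_def Let_def FactRing_def cls_def type_algebra_simps)

lemma add_cls [simp]: "cls L b p \<oplus>\<^bsub>A\<^esub> cls L b q = cls L b (p + q)"
  using ideal.a_rcos_sum[OF A_ideal, of p q]
  by (simp add: A_alg_def Let_def FactRing_def cls_def type_algebra_simps)

lemma one_A: "\<one>\<^bsub>A\<^esub> = cls L b 1"
  by (simp add: A_alg_def Let_def FactRing_def cls_def type_algebra_simps)

lemma zero_A: "\<zero>\<^bsub>A\<^esub> = cls L b 0"
  by (simp add: A_alg_def Let_def FactRing_def cls_eq rel_ideal_eq fun_eq_iff)

lemma smult_cls [simp]: "c \<odot>\<^bsub>A\<^esub> cls L b p = cls L b (Const c * p)"
  using ideal.rcoset_mult_add[OF A_ideal, of "Const c" p]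
  by (simp add: A_alg_def Let_def FactRing_def cls_def type_algebra_simps)

lemma abelian_group_A: "abelian_group A"
proof (rule abelian_groupI)
  fix x assume "x \<in> carrier A"
  then obtain p where "x = cls L b p" by (auto simp: carrier_A)
  then show "\<exists>y\<in>carrier A. y \<oplus>\<^bsub>A\<^esub> x = \<zero>\<^bsub>A\<^esub>"
    by (intro bexI[of _ "cls L b (- p)"]) (simp_all add: zero_A)
qed (auto simp: carrier_A zero_A add_ac)

lemma finsum_cls:
  assumes "finite I"
  shows "finsum A (\<lambda>i. cls L b (g i)) I = cls L b (sum g I)"
proof -
  interpret abelian_group A by (rule abelian_group_A)
  show ?thesis using assms by (induction I) (simp_all add: zero_A)
qed

lemma pow_cls: "cls L b p [^]\<^bsub>A\<^esub> (n::nat) = cls L b (p ^ n)"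
proof (induction n)
  case (Suc n)
  then show ?case by (simp add: nat_pow_def mult.commute)
qed (simp add: nat_pow_def one_A)

lemma minus_cls: "cls L b p \<ominus>\<^bsub>A\<^esub> cls L b q = cls L b (p - q)"
proof -
  interpret abelian_group A by (rule abelian_group_A)
  have "\<ominus>\<^bsub>A\<^esub> cls L b q = cls L b (- q)" by (rule minus_equality) (simp_all add: zero_A)
  then show ?thesis by (simp add: a_minus_def)
qed

text \<open>All corner monomials are proportional modulo the ideal, which gives existence.
  Uniqueness follows from the condition at \<open>m0\<close> alone, where \<open>b m0\<close> can be
  divided out.\<close>

lemma x_corn_eq:
  assumes "m0 \<in> corn L" "b m0 \<noteq> 0"
  shows "x_corn L b = cls L b (Const (1 / b m0) * monomial m0)"
  unfolding x_corn_def
proof (rule the_equality)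
  have "co (monomial m) j = b m * (1 / b m0 * co (monomial m0) j)" if "m \<in> corn L" for m j
    using assms that by (auto simp: co_monomial split: coord.splits)
  then show "cls L b (Const (1 / b m0) * monomial m0) \<in> carrier A \<and> (\<forall>m\<in>corn L.
      cls L b (monomial m) = b m \<odot>\<^bsub>A\<^esub> cls L b (Const (1 / b m0) * monomial m0))"
    by (simp add: cls_eq_iff co_Const_mult fun_eq_iff)
next
  fix e assume e: "e \<in> carrier A \<and> (\<forall>m\<in>corn L. cls L b (monomial m) = b m \<odot>\<^bsub>A\<^esub> e)"
  then obtain p where p: "e = cls L b p" by (auto simp: carrier_A)
  have "co (monomial m0) j = b m0 * co p j" for j
    using e assms by (simp add: p cls_eq_iff co_Const_mult fun_eq_iff)
  then show "e = cls L b (Const (1 / b m0) * monomial m0)"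
    using assms by (simp add: p cls_eq_iff co_Const_mult fun_eq_iff)
qed

definition corner0 :: "'k expo"
  where "corner0 = (SOME m. m \<in> corn L \<and> b m \<noteq> 0)"

lemma corner0: "corner0 \<in> corn L" "b corner0 \<noteq> 0"
  using someI_ex[of "\<lambda>m. m \<in> corn L \<and> b m \<noteq> 0"] b_nonzero by (auto simp: corner0_def)

definition bpoly :: "'k coord \<Rightarrow> ('k, 'a) mpoly"
  where "bpoly j = (case j of Cell l \<Rightarrow> monomial l
    | Corner \<Rightarrow> Const (1 / b corner0) * monomial corner0)"

text \<open>A section of \<open>co\<close>: it realises any choice of values on
  \<open>coords L\<close> by a class, so a statement about all elements of the algebra is one about
  all points of coordinate space.\<close>

definition lift :: "('k coord \<Rightarrow> 'a) \<Rightarrow> ('k, 'a) mpoly"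
  where "lift v = (\<Sum>j\<in>coords L. Const (v j) * bpoly j)"

lemma co_bpoly: "i \<in> coords L \<Longrightarrow> co (bpoly i) j = (if i = j then 1 else 0)"
  using corner0
  by (auto simp: bpoly_def co_monomial co_Const_mult coords_def split: coord.splits)

lemma co_lift: "co (lift v) j = (if j \<in> coords L then v j else 0)"
  by (simp add: lift_def co_sum co_Const_mult co_bpoly if_distrib sum.delta cong: if_cong)

lemma coord_of_cls: "coord_of L b (cls L b p) = co p"
proof -
  have basis: "basis_elem L b j = cls L b (bpoly j)" for j
    using corner0 by (cases j) (simp_all add: bpoly_def x_corn_eq)
  have "finsum A (\<lambda>j. v j \<odot>\<^bsub>A\<^esub> basis_elem L b j) (coords L) = cls L b (lift v)" for v
    by (simp add: basis finsum_cls lift_def)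
  then have "coord_of L b (cls L b p) = (THE v. (\<forall>j. j \<notin> coords L \<longrightarrow> v j = 0) \<and> co p = co (lift v))"
    by (simp add: coord_of_def cls_eq_iff)
  also have "\<dots> = co p"
    by (rule the_equality) (auto simp: co_lift co_outside fun_eq_iff)
  finally show ?thesis .
qed

lemma U_space_eq: "U_space L b = {cls L b p | p. co p (Cell 0) = 0 \<and> co p Corner = 0}"
proof -
  have fin: "finite (U_cells L)" by (simp add: U_cells_def)
  have U: "U_space L b = {cls L b (\<Sum>l\<in>U_cells L. Const (c l) * monomial l) | c. True}"
    by (simp add: U_space_def finsum_cls[OF fin])
  have co_mon: "co (monomial l) j = (if j = Cell l then 1 else 0)" if "l \<in> U_cells L" for l j
    using that co_bpoly[of "Cell l" j] by (auto simp: bpoly_def U_cells_def coords_def)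
  have *: "co (\<Sum>l\<in>U_cells L. Const (c l) * monomial l) j
      = (\<Sum>l\<in>U_cells L. if j = Cell l then c l else 0)" for c j
    by (auto simp: co_sum co_Const_mult co_mon intro!: sum.cong)
  show ?thesis
  proof (intro subset_antisym subsetI)
    fix x assume "x \<in> U_space L b"
    then obtain c where "x = cls L b (\<Sum>l\<in>U_cells L. Const (c l) * monomial l)"
      unfolding U by blast
    then show "x \<in> {cls L b p | p. co p (Cell 0) = 0 \<and> co p Corner = 0}"
      by (auto intro!: exI[of _ "\<Sum>l\<in>U_cells L. Const (c l) * monomial l"] sum.neutral
          simp only: * mem_Collect_eq) (auto simp: U_cells_def)
  next
    fix x assume "x \<in> {cls L b p | p. co p (Cell 0) = 0 \<and> co p Corner = 0}"
    then obtain p where p: "x = cls L b p" "co p (Cell 0) = 0" "co p Corner = 0" by blast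
    have "co p j = co (\<Sum>l\<in>U_cells L. Const (co p (Cell l)) * monomial l) j" for j
    proof (cases j)
      case (Cell m)
      have "co p (Cell m) = 0" if "m \<notin> U_cells L"
        using that p(2) co_outside[of "Cell m" p] by (cases "m = 0") (auto simp: U_cells_def coords_def)
      then show ?thesis unfolding * using fin by (simp add: Cell)
    next
      case Corner
      then show ?thesis unfolding * using p(3) by simp
    qed
    then have "x = cls L b (\<Sum>l\<in>U_cells L. Const (co p (Cell l)) * monomial l)"
      unfolding p(1) cls_eq_iff by (rule ext)
    then show "x \<in> U_space L b"
      unfolding U mem_Collect_eq by (intro exI[of _ "\<lambda>l. co p (Cell l)"] conjI TrueI)
  qed
qed

text \<open>A common bound for the nilpotency of all elements of the maximal ideal; it need not be
  the exact index.\<close>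

definition nil_bound :: nat
  where "nil_bound = Suc (Max (expo_deg ` L))"

lemma co_power_eq_0:
  assumes "Poly_Mapping.lookup p 0 = 0" "nil_bound \<le> n"
  shows "co (p ^ n) j = 0"
proof -
  have "Poly_Mapping.lookup (p ^ n) m = 0" if "m \<in> L" for m
  proof (rule lookup_power_eq_0[OF assms(1)])
    have "expo_deg m \<le> Max (expo_deg ` L)" using that by (intro Max_ge) auto
    then show "expo_deg m < n" using assms(2) by (simp add: nil_bound_def)
  qed
  then show ?thesis by (auto simp: co_def corn_in_L split: coord.splits)
qed

text \<open>The index set in the definitions of \<open>alg_exp\<close> and \<open>alg_ln1p\<close>
  depends on the element. The added powers are zero in the algebra, so a range common to all
  elements gives the same sum.\<close>

lemma nilpotent_series:
  assumes "Poly_Mapping.lookup p 0 = 0"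
  shows "finsum A (\<lambda>n. c n \<odot>\<^bsub>A\<^esub> (cls L b p [^]\<^bsub>A\<^esub> n))
      {n::nat. Q n \<and> cls L b p [^]\<^bsub>A\<^esub> n \<noteq> \<zero>\<^bsub>A\<^esub>}
    = cls L b (\<Sum>n | n < nil_bound \<and> Q n. Const (c n) * p ^ n)"
proof -
  have sub: "{n. Q n \<and> cls L b p [^]\<^bsub>A\<^esub> n \<noteq> \<zero>\<^bsub>A\<^esub>} \<subseteq> {n. n < nil_bound \<and> Q n}" (is "?S \<subseteq> ?T")
    using co_power_eq_0[OF assms] by (auto simp: pow_cls zero_A cls_eq_iff fun_eq_iff not_less[symmetric])
  have fin: "finite ?T" by simp
  have "finsum A (\<lambda>n. c n \<odot>\<^bsub>A\<^esub> (cls L b p [^]\<^bsub>A\<^esub> n)) ?S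
      = cls L b (\<Sum>n\<in>?S. Const (c n) * p ^ n)"
    using finsum_cls[OF finite_subset[OF sub fin]] by (simp add: pow_cls)
  also have "\<dots> = cls L b (\<Sum>n\<in>?T. Const (c n) * p ^ n)"
    unfolding cls_eq_iff fun_eq_iff co_sum co_Const_mult
    by (intro allI sum.mono_neutral_left fin sub)
      (auto simp: pow_cls zero_A cls_eq_iff fun_eq_iff)
  finally show ?thesis .
qed

lemma alg_exp_cls:
  "Poly_Mapping.lookup p 0 = 0 \<Longrightarrow>
    alg_exp A (cls L b p) = cls L b (\<Sum>n<nil_bound. Const (1 / fact n) * p ^ n)"
  using nilpotent_series[of p "\<lambda>n. 1 / fact n" "\<lambda>_. True"] by (simp add: alg_exp_def lessThan_def)

lemma alg_ln1p_cls:
  "Poly_Mapping.lookup p 0 = 0 \<Longrightarrow> alg_ln1p A (cls L b p) =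
    cls L b (\<Sum>n | n < nil_bound \<and> 1 \<le> n. Const ((- 1) ^ (n - 1) / of_nat n) * p ^ n)"
  using nilpotent_series[of p "\<lambda>n. (- 1) ^ (n - 1) / of_nat n" "\<lambda>n. 1 \<le> n"]
  by (simp add: alg_ln1p_def)

end

section \<open>Multinomial coefficients and monomials in the coordinates\<close>

lemma multinom_minus_unit_cell:
  assumes "i \<in> Poly_Mapping.keys (m :: ('k::finite) expo)"
  shows "multinom (m - unit_cell i)
    = (multinom m * of_nat (Poly_Mapping.lookup m i) / of_nat (expo_deg m) :: 'a::field_char_0)"
proof -
  define l where "l = m - unit_cell i"
  have m: "m = unit_cell i + l" using assms by (simp add: l_def cell_le_add_diff unit_cell_le_iff)
  have deg: "expo_deg m = Suc (expo_deg l)" by (simp add: m expo_deg_add unit_cell_def)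
  have mi: "Poly_Mapping.lookup m i = Suc (Poly_Mapping.lookup l i)"
    by (simp add: m lookup_add unit_cell_def)
  have "(\<Prod>j\<in>UNIV - {i}. fact (Poly_Mapping.lookup m j) :: 'a)
      = (\<Prod>j\<in>UNIV - {i}. fact (Poly_Mapping.lookup l j))"
    by (intro prod.cong) (auto simp: m lookup_add unit_cell_def lookup_single when_def)
  then have "(\<Prod>j\<in>UNIV. fact (Poly_Mapping.lookup m j) :: 'a)
      = of_nat (Poly_Mapping.lookup m i) * (\<Prod>j\<in>UNIV. fact (Poly_Mapping.lookup l j))"
    by (simp add: prod.remove[of UNIV i] mi mult.assoc del: of_nat_Suc)
  then show ?thesis
    by (simp add: multinom_def deg mi flip: l_def del: of_nat_Suc)
qed

text \<open>A Pascal rule: sequences of unit steps leading to \<open>m\<close> are sorted by their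
  first step. For \<open>m = 0\<close> the sum would be empty, but the coefficient is 1.\<close>

lemma multinom_rec:
  assumes "(m :: ('k::finite) expo) \<noteq> 0"
  shows "(\<Sum>l | l \<preccurlyeq> m \<and> expo_deg l = 1. multinom (m - l)) = (multinom m :: 'a::field_char_0)"
proof -
  have "(\<Sum>l | l \<preccurlyeq> m \<and> expo_deg l = 1. multinom (m - l))
      = (\<Sum>i\<in>Poly_Mapping.keys m. multinom m * of_nat (Poly_Mapping.lookup m i)
          / of_nat (expo_deg m) :: 'a)"
    by (simp only: unit_cells_below sum.reindex[OF inj_unit_cell] comp_def)
      (intro sum.cong refl multinom_minus_unit_cell)
  also have "\<dots> = multinom m * of_nat (expo_deg m) / of_nat (expo_deg m)"
    by (simp add: expo_deg_def sum_distrib_left sum_divide_distrib)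
  finally show ?thesis using assms by simp
qed

lemma z_pow_0 [simp]: "z_pow 0 = 1"
  by (simp add: z_pow_def)

lemma z_pow_add: "z_pow (l + m) = z_pow l * z_pow m"
  by (simp add: z_pow_def lookup_add power_add prod.distrib)

lemma z_pow_unit_cell: "z_pow (unit_cell i) = Var (Cell (unit_cell i))"
proof -
  have "z_pow (unit_cell i) = (\<Prod>j\<in>UNIV. if j = i then Var (Cell (unit_cell j)) else 1)"
    unfolding z_pow_def
    by (intro prod.cong) (auto simp: unit_cell_def lookup_single when_def)
  then show ?thesis by simp
qed

lemma z_pow_minus:
  assumes "l \<preccurlyeq> m" "expo_deg l = 1"
  shows "Var (Cell l) * z_pow (m - l) = z_pow m"
  using assms z_pow_add[of l "m - l"] z_pow_unit_cell
  by (metis cell_le_add_diff expo_deg_eq_1_iff)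

text \<open>With all coordinates except \<open>z_0\<close> frozen, the differences of the parts are
  the coefficients of a univariate polynomial in \<open>z_0\<close> that vanishes
  everywhere.\<close>

lemma z0_decomposition_unique:
  fixes g h :: "nat \<Rightarrow> ('k coord, 'a::field_char_0) mpoly"
  assumes "z0_decomposition L d f g" "z0_decomposition L d f h" "s \<in> {1..d}"
  shows "g s = h s"
proof (rule mpoly_eqI)
  fix v :: "'k coord \<Rightarrow> 'a"
  define P where "P = (\<Sum>s=1..d. monom (meval v (g s) - meval v (h s)) (d - s))"
  have poly_P: "poly P t = 0" for t
  proof -
    let ?v = "v(Cell 0 := t)"
    have "meval ?v (g s) = meval v (g s)" "meval ?v (h s) = meval v (h s)" if "s \<in> {1..d}" for s
    proof -
      have "Cell 0 \<notin> mvars (g s)" "Cell 0 \<notin> mvars (h s)"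
        using that assms(1,2) unfolding z0_decomposition_def by blast+
      then show "meval ?v (g s) = meval v (g s)" "meval ?v (h s) = meval v (h s)"
        by (auto intro!: meval_cong)
    qed
    then have "poly P t = meval ?v (\<Sum>s=1..d. Var (Cell 0) ^ (d - s) * g s)
        - meval ?v (\<Sum>s=1..d. Var (Cell 0) ^ (d - s) * h s)"
      by (simp add: P_def poly_sum poly_monom algebra_simps flip: sum_subtractf)
    moreover have "(\<Sum>s=1..d. Var (Cell 0) ^ (d - s) * g s) = (\<Sum>s=1..d. Var (Cell 0) ^ (d - s) * h s)"
      using assms(1,2) unfolding z0_decomposition_def by simp
    ultimately show ?thesis by (simp only: diff_self)
  qed
  then have "P = 0" using poly_all_0_iff_0 by blast
  have "coeff P (d - s) = (\<Sum>r=1..d. if r = s then meval v (g r) - meval v (h r) else 0)"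
    unfolding P_def coeff_sum using assms(3) by (intro sum.cong) auto
  then show "meval v (g s) = meval v (h s)" using \<open>P = 0\<close> assms(3) by simp
qed

lemma msubst_Const_ident:
  assumes "\<And>i. i \<in> mvars p \<Longrightarrow> v i = Var i"
  shows "msubst Const v p = p"
proof -
  have "msubst Const Var p = p"
    by (rule mpoly_induct[of p UNIV]) simp_all
  moreover have "msubst Const v p = msubst Const Var p"
    by (rule msubst_cong) (rule assms)
  ultimately show ?thesis by simp
qed

lemma meval_z_pow:
  fixes v :: "('k::finite) coord \<Rightarrow> 'a::comm_ring_1"
  shows "meval v (z_pow m) = meval (\<lambda>i. v (Cell (unit_cell i))) (monomial m)"
proof -
  have "meval w (monomial m) = expo_val w m" for w :: "'k \<Rightarrow> 'a"
    by (simp add: meval_conv_msubst monomial_def id_hom.msubst_single)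
  then show ?thesis
    by (simp add: z_pow_def expo_val_superset[of UNIV])
qed

context young_pair
begin

subsection \<open>Exponential and logarithm\<close>

text \<open>Evaluation of a formal power series at a nilpotent class. The truncation is invisible to
  \<open>co\<close>, so products and compositions of series carry over.\<close>

definition ser :: "'a fps \<Rightarrow> ('k, 'a) mpoly \<Rightarrow> ('k, 'a) mpoly"
  where "ser F p = (\<Sum>n<nil_bound. Const (fps_nth F n) * p ^ n)"

lemma co_mult_cong:
  assumes "co p = co p'" "co q = co q'"
  shows "co (p * q) = co (p' * q')"
proof
  fix j
  have "co ((p - p') * q) j = 0" "co ((q - q') * p') j = 0"
    using assms by (intro co_mult_eq_0; simp add: co_diff)+
  moreover have "p * q - p' * q' = (p - p') * q + (q - q') * p'" by (simp add: algebra_simps)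
  ultimately have "co (p * q - p' * q') j = 0" by (simp add: co_add)
  then show "co (p * q) j = co (p' * q') j" by (simp add: co_diff)
qed

lemma co_ser: "co (ser F p) j = (\<Sum>n<nil_bound. fps_nth F n * co (p ^ n) j)"
  by (simp add: ser_def co_sum co_Const_mult)

text \<open>The product of the two truncations has additional terms with \<open>i + k\<close> at
  least \<open>nil_bound\<close>; these powers of \<open>p\<close> vanish under
  \<open>co\<close>.\<close>

lemma ser_mult:
  assumes "Poly_Mapping.lookup p 0 = 0"
  shows "co (ser (F * G) p) = co (ser F p * ser G p)"
proof
  fix j
  define h where "h i k = fps_nth F i * fps_nth G k * co (p ^ (i + k)) j" for i k
  have "co (ser (F * G) p) j = (\<Sum>n<nil_bound. \<Sum>i\<le>n. h i (n - i))"
    by (simp add: co_ser fps_mult_nth h_def sum_distrib_right atLeast0AtMost)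
  also have "\<dots> = (\<Sum>(i, k)\<in>{(i, k). i + k < nil_bound}. h i k)"
    by (rule sum.triangle_reindex[symmetric])
  also have "\<dots> = (\<Sum>(i, k)\<in>{..<nil_bound} \<times> {..<nil_bound}. h i k)"
    by (rule sum.mono_neutral_left) (auto simp: h_def, metis co_power_eq_0[OF assms] not_less)
  also have "\<dots> = co (ser F p * ser G p) j"
    by (simp add: ser_def sum_product co_sum h_def sum.cartesian_product
        power_add Const_mult mult_ac case_prod_beta flip: co_Const_mult)
  finally show "co (ser (F * G) p) j = co (ser F p * ser G p) j" .
qed

lemma nil_bound_gt: "m \<in> L \<Longrightarrow> expo_deg m < nil_bound"
  by (simp add: nil_bound_def less_Suc_eq_le)

lemma nil_bound_ge: "2 \<le> nil_bound"
  using corn_deg_ge_2[OF corner0(1)] nil_bound_gt[OF corn_in_L[OF corner0(1)]] by simp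

lemma ser_1: "ser 1 p = 1"
proof -
  have "ser 1 p = (\<Sum>n<nil_bound. if n = 0 then 1 else 0)"
    unfolding ser_def by (intro sum.cong) auto
  then show ?thesis using nil_bound_ge by simp
qed

lemma ser_X: "ser fps_X p = p"
proof -
  have "ser fps_X p = (\<Sum>n<nil_bound. if n = 1 then p else 0)"
    unfolding ser_def by (intro sum.cong) auto
  then show ?thesis using nil_bound_ge by simp
qed

lemma ser_diff: "ser (F - G) p = ser F p - ser G p"
  by (simp add: ser_def Const_diff left_diff_distrib sum_subtractf)

lemma lookup_ser_0:
  assumes "Poly_Mapping.lookup p 0 = 0" "fps_nth F 0 = 0"
  shows "Poly_Mapping.lookup (ser F p) 0 = 0"
  unfolding ser_def lookup_sum lookup_Const_mult
proof (intro sum.neutral ballI)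
  fix n
  show "fps_nth F n * Poly_Mapping.lookup (p ^ n) 0 = 0"
    using assms lookup_power_eq_0[of p 0 n] by (cases "n = 0") auto
qed

lemma ser_power:
  assumes "Poly_Mapping.lookup p 0 = 0"
  shows "co (ser (F ^ n) p) = co (ser F p ^ n)"
proof (induction n)
  case (Suc n)
  then show ?case
    using co_mult_cong[OF refl Suc, of "ser F p"] by (simp add: ser_mult[OF assms])
qed (simp add: ser_1)

text \<open>As \<open>G\<close> has no constant term, coefficient \<open>n\<close> of
  \<open>G ^ i\<close> is 0 for \<open>i > n\<close>. The inner sum may therefore run up to
  \<open>nil_bound\<close> for every \<open>n\<close>, and the sums can be exchanged.\<close>

lemma ser_compose:
  assumes "Poly_Mapping.lookup p 0 = 0" "fps_nth G 0 = 0"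
  shows "co (ser (F oo G) p) = co (ser F (ser G p))"
proof
  fix j
  have "co (ser (F oo G) p) j
      = (\<Sum>n<nil_bound. \<Sum>i<nil_bound. fps_nth F i * fps_nth (G ^ i) n * co (p ^ n) j)"
    unfolding co_ser fps_compose_nth sum_distrib_right
    by (intro sum.cong refl sum.mono_neutral_left)
      (auto simp: startsby_zero_power_prefix[OF assms(2)])
  also have "\<dots> = (\<Sum>i<nil_bound. fps_nth F i * co (ser (G ^ i) p) j)"
    by (subst sum.swap) (simp add: co_ser sum_distrib_left mult.assoc)
  also have "\<dots> = co (ser F (ser G p)) j"
    by (simp add: co_ser[of F] ser_power[OF assms(1)])
  finally show "co (ser (F oo G) p) j = co (ser F (ser G p)) j" .
qed

lemma alg_exp_ser:
  "Poly_Mapping.lookup p 0 = 0 \<Longrightarrow> alg_exp A (cls L b p) = cls L b (ser (fps_exp 1) p)"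
  by (simp add: alg_exp_cls ser_def)

lemma alg_ln1p_ser:
  assumes "Poly_Mapping.lookup p 0 = 0"
  shows "alg_ln1p A (cls L b p) = cls L b (ser (fps_ln 1) p)"
proof -
  have "ser (fps_ln 1) p = (\<Sum>n | n < nil_bound \<and> 1 \<le> n. Const ((- 1) ^ (n - 1) / of_nat n) * p ^ n)"
    unfolding ser_def by (intro sum.mono_neutral_cong_right) (auto simp: fps_ln_nth)
  then show ?thesis by (simp add: alg_ln1p_cls[OF assms])
qed

text \<open>\<open>fps_ln 1\<close> is the series of ln(1 + X), the compositional inverse of
  \<open>fps_exp 1 - 1\<close>.\<close>

lemma ln_exp:
  assumes "Poly_Mapping.lookup p 0 = 0"
  shows "co (ser (fps_ln 1) (ser (fps_exp 1) p - 1)) = co p"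
  using ser_compose[OF assms, of "fps_exp 1 - 1" "fps_ln 1"]
  by (simp add: fps_ln_fps_exp_inv fps_inv_fps_exp_compose ser_X ser_diff ser_1)

lemma exp_ln:
  assumes "Poly_Mapping.lookup p 0 = 0"
  shows "co (ser (fps_exp 1) (ser (fps_ln 1) p)) = co (1 + p)"
proof -
  have "co (ser (fps_exp 1 - 1) (ser (fps_ln 1) p)) = co p"
    using ser_compose[OF assms fps_ln_0, of "fps_exp 1 - 1" 1]
    by (simp add: fps_ln_fps_exp_inv fps_inv_fps_exp_compose ser_X)
  then show ?thesis
    by (simp add: fun_eq_iff ser_diff ser_1 co_diff co_add algebra_simps)
qed

text \<open>For \<open>q = z_0 + z\<close> this is \<open>z / z_0\<close>, the argument at which
  ln(1 + X) is evaluated.\<close>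

definition unip :: "('k, 'a) mpoly \<Rightarrow> ('k, 'a) mpoly"
  where "unip q = Const (1 / Poly_Mapping.lookup q 0) * q - 1"

lemma lookup_unip_0: "Poly_Mapping.lookup q 0 \<noteq> 0 \<Longrightarrow> Poly_Mapping.lookup (unip q) 0 = 0"
  by (simp add: unip_def lookup_minus lookup_Const_mult)

lemma exp_cone_eq:
  "{c \<odot>\<^bsub>A\<^esub> alg_exp A u | c u. c \<noteq> 0 \<and> u \<in> U_space L b} =
    {cls L b q | q. Poly_Mapping.lookup q 0 \<noteq> 0 \<and> co (ser (fps_ln 1) (unip q)) Corner = 0}"
proof (intro subset_antisym subsetI)
  fix x assume "x \<in> {c \<odot>\<^bsub>A\<^esub> alg_exp A u | c u. c \<noteq> 0 \<and> u \<in> U_space L b}"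
  then obtain c p where c: "c \<noteq> 0" and p: "Poly_Mapping.lookup p 0 = 0" "co p Corner = 0"
    and x: "x = c \<odot>\<^bsub>A\<^esub> alg_exp A (cls L b p)"
    by (auto simp: U_space_eq co_Cell_0)
  let ?q = "Const c * ser (fps_exp 1) p"
  \<comment> \<open>The exponential has constant term 1, so the scalar \<open>c\<close> is recovered
    as the constant term of \<open>?q\<close>.\<close>
  have "ser (fps_exp 1) p = 1 + ser (fps_exp 1 - 1) p"
    by (simp add: ser_diff ser_1)
  then have "Poly_Mapping.lookup (ser (fps_exp 1) p) 0 = 1"
    using lookup_ser_0[OF p(1), of "fps_exp 1 - 1"] by (simp add: lookup_add)
  then have q0: "Poly_Mapping.lookup ?q 0 = c" by (simp add: lookup_Const_mult)
  then have "unip ?q = ser (fps_exp 1) p - 1"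
    using c by (simp add: unip_def flip: mult.assoc Const_mult)
  then have "co (ser (fps_ln 1) (unip ?q)) Corner = 0"
    using ln_exp[OF p(1)] p(2) by simp
  with q0 c have "\<exists>q. x = cls L b q \<and> Poly_Mapping.lookup q 0 \<noteq> 0
      \<and> co (ser (fps_ln 1) (unip q)) Corner = 0"
    by (intro exI[of _ ?q]) (simp add: x alg_exp_ser[OF p(1)])
  then show "x \<in> {cls L b q | q. Poly_Mapping.lookup q 0 \<noteq> 0
      \<and> co (ser (fps_ln 1) (unip q)) Corner = 0}" by blast
next
  fix x assume "x \<in> {cls L b q | q. Poly_Mapping.lookup q 0 \<noteq> 0
      \<and> co (ser (fps_ln 1) (unip q)) Corner = 0}"
  then obtain q where q: "x = cls L b q" "Poly_Mapping.lookup q 0 \<noteq> 0"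
    "co (ser (fps_ln 1) (unip q)) Corner = 0" by blast
  \<comment> \<open>The witnesses are the scalar \<open>z_0\<close> and the logarithm; the latter
    lies in \<open>U\<close> because its \<open>Corner\<close> coordinate vanishes by
    assumption.\<close>
  define p where "p = ser (fps_ln 1) (unip q)"
  have p0: "Poly_Mapping.lookup p 0 = 0"
    unfolding p_def using q by (intro lookup_ser_0 lookup_unip_0) simp_all
  have U: "cls L b p \<in> U_space L b"
    using p0 q(3) by (auto simp: U_space_eq co_Cell_0 p_def)
  have "co (ser (fps_exp 1) p) = co (1 + unip q)"
    unfolding p_def using q by (intro exp_ln lookup_unip_0)
  then have "co (Const (Poly_Mapping.lookup q 0) * ser (fps_exp 1) p)
      = co (Const (Poly_Mapping.lookup q 0) * (1 + unip q))"
    by (intro co_mult_cong refl)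
  also have "Const (Poly_Mapping.lookup q 0) * (1 + unip q) = q"
    using q by (simp add: unip_def flip: mult.assoc Const_mult)
  finally have "x = Poly_Mapping.lookup q 0 \<odot>\<^bsub>A\<^esub> alg_exp A (cls L b p)"
    by (simp add: alg_exp_ser[OF p0] cls_eq_iff q(1))
  then show "x \<in> {c \<odot>\<^bsub>A\<^esub> alg_exp A u | c u. c \<noteq> 0 \<and> u \<in> U_space L b}"
    using U q(2) by blast
qed

subsection \<open>The equation\<close>

text \<open>\<open>coef_poly s m\<close> is the coefficient of \<open>x\<^sup>m\<close> in the \<open>s\<close>-th power of the generic element
  \<open>\<Sum> z\<^sub>\<lambda> x\<^sup>\<lambda>\<close> of \<open>U\<close>, before passing to the quotient.\<close>

primrec coef_poly :: "nat \<Rightarrow> 'k expo \<Rightarrow> ('k coord, 'a) mpoly"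
  where
    "coef_poly 0 m = (if m = 0 then 1 else 0)"
  | "coef_poly (Suc s) m = (\<Sum>l | l \<in> U_cells L \<and> l \<preccurlyeq> m. Var (Cell l) * coef_poly s (m - l))"

lemma finite_U_cells [simp]: "finite (U_cells L)"
  by (simp add: U_cells_def)

lemma mvars_coef_poly: "mvars (coef_poly s m) \<subseteq> Cell ` U_cells L"
proof (induction s arbitrary: m)
  case (Suc s)
  have "mvars (Var (Cell l) * coef_poly s (m - l)) \<subseteq> Cell ` U_cells L" if "l \<in> U_cells L" for l
    using Suc[of "m - l"] mvars_mult[of "Var (Cell l)" "coef_poly s (m - l)"] that by fastforce
  then show ?case unfolding coef_poly.simps
    by (intro order.trans[OF mvars_sum]) blast
qed simp

lemma homogeneous_coef_poly: "homogeneous s (coef_poly s m)"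
proof (induction s arbitrary: m)
  case (Suc s)
  then show ?case unfolding coef_poly.simps
    using homogeneous_mult[OF homogeneous_Var Suc] by (intro homogeneous_sum) simp
qed simp

lemma U_cells_deg: "l \<in> U_cells L \<Longrightarrow> 1 \<le> expo_deg l"
  using expo_deg_eq_0_iff[of l] by (auto simp: U_cells_def Suc_le_eq simp del: expo_deg_eq_0_iff)

lemma coef_poly_eq_0: "expo_deg m < s \<Longrightarrow> coef_poly s m = 0"
proof (induction s arbitrary: m)
  case (Suc s)
  have "coef_poly s (m - l) = 0" if "l \<in> U_cells L" "l \<preccurlyeq> m" for l
    using that Suc.prems U_cells_deg[of l] expo_deg_mono[of l m]
    by (intro Suc.IH) (simp add: expo_deg_cell_diff)
  then show ?case by simp
qed simp

text \<open>All cells below a non-corner cell are non-corner cells, so only coefficients of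
  \<open>p\<close> that are coordinates enter.\<close>

lemma lookup_power_noncorner:
  assumes "Poly_Mapping.lookup p 0 = 0" "m \<in> L - corn L"
  shows "Poly_Mapping.lookup (p ^ s) m = meval (co p) (coef_poly s m)"
  using assms(2)
proof (induction s arbitrary: m)
  case 0
  then show ?case by (simp add: lookup_one)
next
  case (Suc s)
  have below: "l \<in> L - corn L" if "l \<preccurlyeq> m" for l
    using noncorner_if_less[of m l] that Suc.prems by (cases "l = m") auto
  have "Poly_Mapping.lookup (p ^ Suc s) m
      = (\<Sum>l | l \<preccurlyeq> m. Poly_Mapping.lookup p l * Poly_Mapping.lookup (p ^ s) (m - l))"
    by (simp add: lookup_mult_cells)
  also have "\<dots> = (\<Sum>l | l \<in> U_cells L \<and> l \<preccurlyeq> m. co p (Cell l) * meval (co p) (coef_poly s (m - l)))"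
  proof (rule sum.mono_neutral_cong_right)
    show "\<forall>l\<in>{l. l \<preccurlyeq> m} - {l \<in> U_cells L. l \<preccurlyeq> m}.
        Poly_Mapping.lookup p l * Poly_Mapping.lookup (p ^ s) (m - l) = 0"
      using below assms(1) by (auto simp: U_cells_def)
  next
    fix l assume "l \<in> {l \<in> U_cells L. l \<preccurlyeq> m}"
    then show "Poly_Mapping.lookup p l * Poly_Mapping.lookup (p ^ s) (m - l)
        = co p (Cell l) * meval (co p) (coef_poly s (m - l))"
      using below[of l] below[of "m - l"] Suc.IH[of "m - l"] by (simp add: co_Cell)
  qed auto
  finally show ?case by simp
qed

text \<open>The coefficient of \<open>p\<close> at \<open>m\<close> itself is not a coordinate. For
  \<open>s\<close> at least 2 it is multiplied by the constant term of \<open>p ^ (s - 1)\<close>,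
  which is 0; this fails for \<open>s = 1\<close>.\<close>

lemma lookup_power_corner:
  assumes "Poly_Mapping.lookup p 0 = 0" "m \<in> corn L" "2 \<le> s"
  shows "Poly_Mapping.lookup (p ^ s) m = meval (co p) (coef_poly s m)"
proof -
  obtain r where s: "s = Suc r" "1 \<le> r" using assms(3) by (cases s) auto
  have below: "l \<in> L - corn L" if "l \<preccurlyeq> m" "l \<noteq> m" for l
    using noncorner_if_less[OF corn_in_L[OF assms(2)]] that by simp
  have r0: "Poly_Mapping.lookup (p ^ r) 0 = 0"
    using lookup_power_eq_0[OF assms(1), of 0 r] s(2) by simp
  have "Poly_Mapping.lookup (p ^ s) m
      = (\<Sum>l | l \<preccurlyeq> m. Poly_Mapping.lookup p l * Poly_Mapping.lookup (p ^ r) (m - l))"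
    by (simp add: lookup_mult_cells s)
  also have "\<dots> = (\<Sum>l | l \<in> U_cells L \<and> l \<preccurlyeq> m. co p (Cell l) * meval (co p) (coef_poly r (m - l)))"
  proof (rule sum.mono_neutral_cong_right)
    show "\<forall>l\<in>{l. l \<preccurlyeq> m} - {l \<in> U_cells L. l \<preccurlyeq> m}.
        Poly_Mapping.lookup p l * Poly_Mapping.lookup (p ^ r) (m - l) = 0"
    proof
      fix l assume l: "l \<in> {l. l \<preccurlyeq> m} - {l \<in> U_cells L. l \<preccurlyeq> m}"
      then consider "l = m" | "l = 0" using below[of l] by (auto simp: U_cells_def)
      then show "Poly_Mapping.lookup p l * Poly_Mapping.lookup (p ^ r) (m - l) = 0"
        by cases (simp_all add: r0 assms(1))
    qed
  next
    fix l assume "l \<in> {l \<in> U_cells L. l \<preccurlyeq> m}"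
    then have l: "l \<in> L - corn L" "l \<preccurlyeq> m" "l \<noteq> 0" by (auto simp: U_cells_def)
    have "m - l \<noteq> m" using l cell_le_add_diff[of l m] by (metis add_cancel_left_left)
    then show "Poly_Mapping.lookup p l * Poly_Mapping.lookup (p ^ r) (m - l)
        = co p (Cell l) * meval (co p) (coef_poly r (m - l))"
      using below[of "m - l"] lookup_power_noncorner[OF assms(1), of "m - l" r] l
      by (simp add: co_Cell)
  qed auto
  finally show ?thesis by (simp add: s)
qed

text \<open>The remaining \<open>s\<close> factors have degree at least 1 each, so a first factor
  with a non-zero term has degree at most \<open>expo_deg m - s\<close>, hence at most 2. One
  statement serves both the top and the second case.\<close>

lemma coef_poly_split:
  assumes "expo_deg m \<le> s + 2" "\<And>l. l \<preccurlyeq> m \<Longrightarrow> expo_deg l \<in> {1, expo_deg m - s} \<Longrightarrow> l \<in> U_cells L"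
  shows "coef_poly (Suc s) m
    = (\<Sum>l | l \<preccurlyeq> m \<and> expo_deg l \<in> {1, expo_deg m - s} - {0}. Var (Cell l) * coef_poly s (m - l))"
  unfolding coef_poly.simps
proof (rule sum.mono_neutral_right)
  show "{l. l \<preccurlyeq> m \<and> expo_deg l \<in> {1, expo_deg m - s} - {0}} \<subseteq> {l. l \<in> U_cells L \<and> l \<preccurlyeq> m}"
    using assms(2) by auto
  show "\<forall>l\<in>{l. l \<in> U_cells L \<and> l \<preccurlyeq> m} - {l. l \<preccurlyeq> m \<and> expo_deg l \<in> {1, expo_deg m - s} - {0}}.
      Var (Cell l) * coef_poly s (m - l) = 0"
  proof
    fix l assume l: "l \<in> {l. l \<in> U_cells L \<and> l \<preccurlyeq> m}
        - {l. l \<preccurlyeq> m \<and> expo_deg l \<in> {1, expo_deg m - s} - {0}}"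
    then have "expo_deg (m - l) < s \<or> expo_deg m < s \<or> expo_deg m = s \<and> s = 0"
      using assms(1) U_cells_deg[of l] expo_deg_mono[of l m] by (auto simp: expo_deg_cell_diff)
    then have "expo_deg (m - l) < s"
      using expo_deg_mono[of "m - l" m] l U_cells_deg[of l] expo_deg_mono[of l m] by auto
    then show "Var (Cell l) * coef_poly s (m - l) = 0" by (simp add: coef_poly_eq_0)
  qed
qed simp

text \<open>With as many factors as the degree of \<open>m\<close>, all factors are unit cells.
  Every ordering gives \<open>z_pow m\<close>, and \<open>multinom_rec\<close> counts the
  orderings.\<close>

lemma coef_poly_top:
  assumes "expo_deg m = s" "\<And>l. l \<preccurlyeq> m \<Longrightarrow> expo_deg l = 1 \<Longrightarrow> l \<in> U_cells L"
  shows "coef_poly s m = Const (multinom m) * z_pow m"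
  using assms
proof (induction s arbitrary: m)
  case 0
  then show ?case by (simp add: multinom_def)
next
  case (Suc s)
  have IH: "coef_poly s (m - l) = Const (multinom (m - l)) * z_pow (m - l)"
    if "l \<preccurlyeq> m" "expo_deg l = 1" for l
  proof (rule Suc.IH)
    show "expo_deg (m - l) = s" using that Suc.prems by (simp add: expo_deg_cell_diff)
    show "k \<in> U_cells L" if "k \<preccurlyeq> m - l" "expo_deg k = 1" for k
      using Suc.prems(2)[of k] cell_le_trans[OF that(1) cell_diff_le] that by simp
  qed
  have "coef_poly (Suc s) m
      = (\<Sum>l | l \<preccurlyeq> m \<and> expo_deg l = 1. Var (Cell l) * coef_poly s (m - l))"
    using coef_poly_split[of m s] Suc.prems by simp
  also have "\<dots> = (\<Sum>l | l \<preccurlyeq> m \<and> expo_deg l = 1. Const (multinom (m - l)) * z_pow m)"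
    by (intro sum.cong refl) (auto simp: IH mult.left_commute[of _ "Const _"] z_pow_minus[unfolded One_nat_def])
  also have "\<dots> = Const (multinom m) * z_pow m"
    using Suc.prems by (subst multinom_rec[of m, symmetric]) (auto simp: Const_sum sum_distrib_right)
  finally show ?case .
qed

text \<open>Exactly one of the \<open>s\<close> factors has degree 2, and \<open>of_nat s\<close>
  counts its positions. In the induction step it either comes first, giving one copy of the sum, or
  follows a unit cell, giving the copies of the induction hypothesis.\<close>

lemma coef_poly_second:
  assumes "expo_deg m = Suc s"
    and "\<And>l. l \<preccurlyeq> m \<Longrightarrow> expo_deg l = 1 \<or> expo_deg l = 2 \<Longrightarrow> l \<in> U_cells L"
  shows "coef_poly s m = of_nat s * (\<Sum>n | expo_deg n = 2 \<and> n \<preccurlyeq> m.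
    Const (multinom (m - n)) * Var (Cell n) * z_pow (m - n))"
  using assms
proof (induction s arbitrary: m)
  case 0
  then show ?case by auto
next
  case (Suc s)
  let ?t = "\<lambda>m n. Const (multinom (m - n)) * Var (Cell n) * z_pow (m - n) :: ('k coord, 'a) mpoly"
  let ?Q = "\<lambda>m. \<Sum>n | expo_deg n = 2 \<and> n \<preccurlyeq> m. ?t m n"
  define U1 where "U1 = {l. l \<preccurlyeq> m \<and> expo_deg l = 1}"
  define U2 where "U2 = {l. expo_deg l = 2 \<and> l \<preccurlyeq> m}"
  have fin: "finite U1" "finite U2"
    by (auto simp: U1_def U2_def intro: finite_subset[OF _ finite_cells_below])
  have sub: "k \<in> U_cells L" if "k \<preccurlyeq> m - l" "expo_deg k = 1 \<or> expo_deg k = 2" for k l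
    using Suc.prems(2)[of k] cell_le_trans[OF that(1) cell_diff_le] that by simp
  have IH1: "coef_poly s (m - l) = of_nat s * ?Q (m - l)" if "l \<in> U1" for l
    using that Suc.prems sub by (intro Suc.IH) (simp_all add: U1_def expo_deg_cell_diff)
  have IH2: "coef_poly s (m - l) = Const (multinom (m - l)) * z_pow (m - l)" if "l \<in> U2" for l
    using that Suc.prems sub by (intro coef_poly_top) (auto simp: U2_def expo_deg_cell_diff)
  have add_le: "n \<preccurlyeq> m - l \<longleftrightarrow> l + n \<preccurlyeq> m" if "l \<preccurlyeq> m" for l n :: "'k expo"
    using that by (auto simp: cell_le_def lookup_add lookup_minus le_diff_conv2 add.commute)
  have diff_diff: "m - l - n = m - n - l" for l n :: "'k expo"
    by (rule poly_mapping_eqI) (simp add: lookup_minus diff_right_commute)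
  have "coef_poly (Suc s) m = (\<Sum>l\<in>U1 \<union> U2. Var (Cell l) * coef_poly s (m - l))"
    using coef_poly_split[of m s] Suc.prems
    by (auto simp: U1_def U2_def intro!: sum.cong)
  also have "\<dots> = (\<Sum>l\<in>U1. Var (Cell l) * coef_poly s (m - l))
      + (\<Sum>l\<in>U2. Var (Cell l) * coef_poly s (m - l))"
    using fin by (rule sum.union_disjoint) (auto simp: U1_def U2_def)
  also have "(\<Sum>l\<in>U2. Var (Cell l) * coef_poly s (m - l)) = ?Q m"
    by (simp add: IH2 U2_def mult_ac)
  also have "(\<Sum>l\<in>U1. Var (Cell l) * coef_poly s (m - l))
      = of_nat s * (\<Sum>l\<in>U1. \<Sum>n\<in>{n\<in>U2. l + n \<preccurlyeq> m}. Var (Cell l) * ?t (m - l) n)"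
  proof -
    have "{n. expo_deg n = 2 \<and> n \<preccurlyeq> m - l} = {n\<in>U2. l + n \<preccurlyeq> m}" if "l \<in> U1" for l
      using that cell_le_trans[of _ "m - l" m] by (auto simp: U1_def U2_def add_le)
    then show ?thesis
      by (simp add: IH1 sum_distrib_left mult_ac cong: sum.cong)
  qed
  \<comment> \<open>With the cell \<open>n\<close> of degree 2 fixed, the sum over the first unit
    cell becomes the recursion for \<open>multinom (m - n)\<close>.\<close>
  also have "\<dots> = of_nat s * (\<Sum>n\<in>U2. \<Sum>l\<in>{l\<in>U1. l + n \<preccurlyeq> m}. Var (Cell l) * ?t (m - l) n)"
    by (subst sum.swap_restrict[OF fin]) simp
  also have "\<dots> = of_nat s * ?Q m"
  \<comment> \<open>For \<open>s = 0\<close> the difference \<open>m - n\<close> is 0 and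
    \<open>multinom_rec\<close> does not apply, but the factor \<open>of_nat s\<close>
    vanishes.\<close>
  proof (cases "s = 0")
    case False
    have "(\<Sum>l\<in>{l\<in>U1. l + n \<preccurlyeq> m}. Var (Cell l) * ?t (m - l) n) = ?t m n" if n: "n \<in> U2" for n
    proof -
      have "expo_deg (m - n) = s" using n Suc.prems(1) by (simp add: U2_def expo_deg_cell_diff)
      with False have nz: "m - n \<noteq> 0" by auto
      have "{l\<in>U1. l + n \<preccurlyeq> m} = {l. l \<preccurlyeq> m - n \<and> expo_deg l = 1}"
        using n cell_le_trans[of _ "m - n" m] by (auto simp: U1_def U2_def add_le add.commute)
      then have "(\<Sum>l\<in>{l\<in>U1. l + n \<preccurlyeq> m}. Var (Cell l) * ?t (m - l) n)
          = (\<Sum>l | l \<preccurlyeq> m - n \<and> expo_deg l = 1.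
              Const (multinom (m - n - l)) * Var (Cell n) * z_pow (m - n))"
      proof (intro sum.cong)
        fix l assume l: "l \<in> {l. l \<preccurlyeq> m - n \<and> expo_deg l = 1}"
        have "Var (Cell l) * ?t (m - l) n
            = Const (multinom (m - n - l)) * Var (Cell n) * (Var (Cell l) * z_pow (m - n - l))"
          by (simp add: diff_diff[of l n] mult_ac)
        then show "Var (Cell l) * ?t (m - l) n
            = Const (multinom (m - n - l)) * Var (Cell n) * z_pow (m - n)"
          using l by (simp add: z_pow_minus[unfolded One_nat_def])
      qed
      also have "\<dots> = ?t m n"
        unfolding sum_distrib_right[symmetric] Const_sum[symmetric] multinom_rec[OF nz] ..
      finally show ?thesis .
    qed
    then show ?thesis by (simp add: U2_def)
  qed simp
  finally show ?case by (simp add: algebra_simps)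
qed

section \<open>The equation and its homogeneous parts\<close>

definition top_deg :: nat
  where "top_deg = Max (expo_deg ` {m \<in> corn L. b m \<noteq> 0})"

lemma expo_deg_le_top_deg: "m \<in> corn L \<Longrightarrow> b m \<noteq> 0 \<Longrightarrow> expo_deg m \<le> top_deg"
  unfolding top_deg_def by (rule Max_ge) auto

lemma top_corner: "\<exists>m\<in>corn L. b m \<noteq> 0 \<and> expo_deg m = top_deg"
proof -
  have "top_deg \<in> expo_deg ` {m \<in> corn L. b m \<noteq> 0}"
    unfolding top_deg_def using b_nonzero by (intro Max_in) auto
  then show ?thesis by auto
qed

lemma top_deg_ge_2: "2 \<le> top_deg"
  using top_corner corn_deg_ge_2 by fastforce

text \<open>Degree 1 is separate: \<open>coef_poly\<close> uses cells of \<open>U\<close> only and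
  would give 0 at every corner, whereas the linear term of the logarithm is
  \<open>z_corn\<close>.\<close>

definition fpart :: "nat \<Rightarrow> ('k coord, 'a) mpoly"
  where "fpart s = (if s = 1 then Var Corner
    else Const ((- 1) ^ (s - 1) / of_nat s) * (\<Sum>m\<in>corn L. Const (b m) * coef_poly s m))"

definition eqn :: "('k coord, 'a) mpoly"
  where "eqn = (\<Sum>s=1..top_deg. Var (Cell 0) ^ (top_deg - s) * fpart s)"

lemma U_cells_coords: "Cell ` U_cells L \<subseteq> coords L - {Cell 0, Corner}"
  by (auto simp: U_cells_def coords_def)

lemma mvars_fpart: "mvars (fpart s) \<subseteq> coords L - {Cell 0}"
  and mvars_fpart_ne_1: "s \<noteq> 1 \<Longrightarrow> mvars (fpart s) \<subseteq> coords L - {Cell 0, Corner}"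
proof -
  have Const_mult_sub: "mvars (Const c * p) \<subseteq> mvars p" for c and p :: "('k coord, 'a) mpoly"
    using mvars_mult[of "Const c" p] by simp
  have "mvars (Const c * (\<Sum>m\<in>corn L. Const (b m) * coef_poly s m))
      \<subseteq> (\<Union>m\<in>corn L. mvars (Const (b m) * coef_poly s m))" for c
    using Const_mult_sub mvars_sum by (rule order.trans)
  also have "\<dots> \<subseteq> Cell ` U_cells L"
    using Const_mult_sub mvars_coef_poly by (intro UN_least) (rule order.trans)
  finally have "mvars (fpart s) \<subseteq> (if s = 1 then {Corner} else Cell ` U_cells L)"
    by (auto simp: fpart_def)
  moreover have "Corner \<in> coords L" by (simp add: coords_def)
  ultimately show "mvars (fpart s) \<subseteq> coords L - {Cell 0}"
    "s \<noteq> 1 \<Longrightarrow> mvars (fpart s) \<subseteq> coords L - {Cell 0, Corner}"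
    using U_cells_coords by (cases "s = 1"; simp; blast)+
qed

lemma homogeneous_fpart: "homogeneous s (fpart s)"
  using homogeneous_Var[of Corner]
  by (auto simp: fpart_def intro!: homogeneous_Const_mult homogeneous_sum homogeneous_coef_poly)

text \<open>A corner with \<open>b m\<close> non-zero has no room for more than
  \<open>top_deg\<close> factors; this is why the logarithm can be cut off there.\<close>

lemma fpart_eq_0: "top_deg < s \<Longrightarrow> fpart s = 0"
proof -
  assume s: "top_deg < s"
  have "Const (b m) * coef_poly s m = 0" if "m \<in> corn L" for m
    using expo_deg_le_top_deg[OF that] s by (cases "b m = 0") (simp_all add: coef_poly_eq_0)
  then show ?thesis using s top_deg_ge_2 by (simp add: fpart_def)
qed

lemma z0_decomposition_eqn: "z0_decomposition L top_deg eqn fpart"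
  by (simp add: z0_decomposition_def homogeneous_fpart mvars_fpart eqn_def)

lemma zero_in_coords: "Cell 0 \<in> coords L"
  using zero_noncorner by (simp add: coords_def)

lemma mvars_Var0_fpart: "mvars (Var (Cell 0) ^ e * fpart s) \<subseteq> insert (Cell 0) (mvars (fpart s))"
  using mvars_mult[of "Var (Cell 0) ^ e" "fpart s"]
    mvars_power[of "Var (Cell 0) :: ('k coord, 'a) mpoly" e] by auto

lemma mvars_eqn: "mvars eqn \<subseteq> coords L"
proof -
  have "mvars (Var (Cell 0) ^ e * fpart s) \<subseteq> coords L" for e s
    using mvars_Var0_fpart[of e s] mvars_fpart[of s] zero_in_coords by blast
  then show ?thesis unfolding eqn_def by (intro order.trans[OF mvars_sum] UN_least)
qed

lemma homogeneous_eqn: "homogeneous top_deg eqn"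
  unfolding eqn_def
proof (rule homogeneous_sum)
  fix s assume "s \<in> {1..top_deg}"
  then show "homogeneous top_deg (Var (Cell 0) ^ (top_deg - s) * fpart s)"
    using homogeneous_mult[OF homogeneous_Var_power[of "top_deg - s" "Cell 0"] homogeneous_fpart[of s]]
    by simp
qed

lemma co_ln_Corner:
  assumes "Poly_Mapping.lookup p 0 = 0"
  shows "co (ser (fps_ln 1) p) Corner = (\<Sum>s=1..top_deg. meval (co p) (fpart s))"
proof -
  have s: "fps_nth (fps_ln 1) s * co (p ^ s) Corner = meval (co p) (fpart s)" if "1 \<le> s" for s
  proof (cases "s = 1")
    case False
    then have "co (p ^ s) Corner = (\<Sum>m\<in>corn L. b m * meval (co p) (coef_poly s m))"
      using that by (auto simp: co_Corner lookup_power_corner[OF assms] intro!: sum.cong)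
    then show ?thesis using that False by (simp add: fpart_def fps_ln_nth)
  qed (simp add: fpart_def fps_ln_nth)
  have "co (ser (fps_ln 1) p) Corner = (\<Sum>s\<in>{1..<nil_bound}. fps_nth (fps_ln 1) s * co (p ^ s) Corner)"
    unfolding co_ser by (rule sum.mono_neutral_right) (auto simp: fps_ln_nth)
  also have "\<dots> = (\<Sum>s\<in>{1..<nil_bound}. meval (co p) (fpart s))"
    by (intro sum.cong refl s) auto
  also have "\<dots> = (\<Sum>s=1..top_deg. meval (co p) (fpart s))"
  proof (rule sum.mono_neutral_right)
    have "top_deg < nil_bound" using top_corner nil_bound_gt[OF corn_in_L] by metis
    then show "{1..top_deg} \<subseteq> {1..<nil_bound}" by auto
  qed (auto simp: fpart_eq_0)
  finally show ?thesis .
qed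

lemma meval_eqn:
  assumes "Poly_Mapping.lookup q 0 \<noteq> 0"
  shows "meval (co q) eqn = Poly_Mapping.lookup q 0 ^ top_deg * co (ser (fps_ln 1) (unip q)) Corner"
proof -
  let ?z = "Poly_Mapping.lookup q 0"
  \<comment> \<open>Away from \<open>Cell 0\<close>, which no \<open>fpart\<close> contains,
    \<open>unip\<close> only rescales by \<open>1 / z_0\<close>; homogeneity then extracts the
    powers.\<close>
  have "co (unip q) j = (1 / ?z) * co q j" if "j \<in> coords L - {Cell 0}" for j
  proof -
    have "co 1 j = 0" using that co_monomial[of 0 j] zero_noncorner by (auto split: coord.splits)
    then show ?thesis by (simp add: unip_def co_diff co_Const_mult)
  qed
  then have "meval (co (unip q)) (fpart s) = meval (\<lambda>j. (1 / ?z) * co q j) (fpart s)" for s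
    using mvars_fpart[of s] by (intro meval_cong) blast
  then have "meval (co (unip q)) (fpart s) = (1 / ?z) ^ s * meval (co q) (fpart s)" for s
    by (simp only: meval_homogeneous[OF homogeneous_fpart])
  then have "?z ^ top_deg * co (ser (fps_ln 1) (unip q)) Corner
      = (\<Sum>s=1..top_deg. ?z ^ top_deg * ((1 / ?z) ^ s * meval (co q) (fpart s)))"
    by (simp add: co_ln_Corner lookup_unip_0[OF assms] sum_distrib_left)
  also have "\<dots> = (\<Sum>s=1..top_deg. ?z ^ (top_deg - s) * meval (co q) (fpart s))"
    using assms by (intro sum.cong refl) (simp add: power_diff power_one_over)
  also have "\<dots> = meval (co q) eqn" by (simp add: eqn_def co_Cell_0)
  finally show ?thesis ..
qed

lemma X_equation_eq: "X_equation L b top_deg = eqn"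
proof -
  have ln: "coord_of L b (alg_ln1p A (inverse z0 \<odot>\<^bsub>A\<^esub> (cls L b q \<ominus>\<^bsub>A\<^esub> (z0 \<odot>\<^bsub>A\<^esub> \<one>\<^bsub>A\<^esub>)))) Corner
      = co (ser (fps_ln 1) (unip q)) Corner" if "z0 = Poly_Mapping.lookup q 0" "z0 \<noteq> 0" for z0 q
  proof -
    have "Const (inverse z0) * (q - Const z0) = Const (1 / z0) * q - Const (inverse z0 * z0)"
      unfolding Const_mult by (simp add: right_diff_distrib inverse_eq_divide)
    then have "Const (inverse z0) * (q - Const z0) = unip q"
      using that by (simp add: unip_def)
    then show ?thesis
      using that by (simp add: one_A minus_cls alg_ln1p_ser lookup_unip_0 coord_of_cls)
  qed
  have char: "(\<forall>a\<in>carrier A. let A = A; z0 = coord_of L b a (Cell 0);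
           z = a \<ominus>\<^bsub>A\<^esub> (z0 \<odot>\<^bsub>A\<^esub> \<one>\<^bsub>A\<^esub>)
       in z0 \<noteq> 0 \<longrightarrow> meval (coord_of L b a) f
            = z0 ^ top_deg * coord_of L b (alg_ln1p A (inverse z0 \<odot>\<^bsub>A\<^esub> z)) Corner)
    \<longleftrightarrow> (\<forall>q. Poly_Mapping.lookup q 0 \<noteq> 0 \<longrightarrow> meval (co q) f = meval (co q) eqn)" for f
    by (simp add: Let_def carrier_A coord_of_cls co_Cell_0 ln meval_eqn)
  show ?thesis
    unfolding X_equation_def char
  proof (rule the_equality)
    fix f
    assume f: "mvars f \<subseteq> coords L \<and>
      (\<forall>q. Poly_Mapping.lookup q 0 \<noteq> 0 \<longrightarrow> meval (co q) f = meval (co q) eqn)"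
    \<comment> \<open>The values of \<open>f\<close> are prescribed only where \<open>z_0\<close> is
      non-zero; multiplication by \<open>z_0\<close> yields agreement at all points and can be
      cancelled.\<close>
    have "Var (Cell 0) * f = Var (Cell 0) * eqn"
    proof (rule mpoly_eqI)
      fix v
      have "meval v f = meval (co (lift v)) f" "meval v eqn = meval (co (lift v)) eqn"
        using f mvars_eqn by (auto simp: co_lift intro!: meval_cong)
      moreover have "Poly_Mapping.lookup (lift v) 0 = v (Cell 0)"
        using co_lift[of v "Cell 0"] zero_in_coords by (simp add: co_Cell_0)
      ultimately show "meval v (Var (Cell 0) * f) = meval v (Var (Cell 0) * eqn)"
        using f by (cases "v (Cell 0) = 0") simp_all
    qed
    then show "f = eqn" by (rule mpoly_mult_left_cancel[OF Var_neq_0])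
  qed (simp add: mvars_eqn)
qed

section \<open>The two top parts of the equation\<close>

lemma below_corner:
  assumes "m \<in> corn L" "l \<preccurlyeq> m" "0 < expo_deg l" "expo_deg l < expo_deg m"
  shows "l \<in> U_cells L"
  using assms noncorner_if_less[OF corn_in_L[OF assms(1)] assms(2)] by (auto simp: U_cells_def)

text \<open>Corners of smaller degree are too small for \<open>top_deg\<close> factors, and corners
  of larger degree have \<open>b m = 0\<close>.\<close>

lemma fpart_top:
  "fpart top_deg = Const ((- 1) ^ (top_deg - 1) / of_nat top_deg) *
    (\<Sum>m\<in>{m \<in> corn L. expo_deg m = top_deg}. Const (multinom m * b m) * z_pow m)"
proof -
  have "(\<Sum>m\<in>corn L. Const (b m) * coef_poly top_deg m)
      = (\<Sum>m\<in>{m \<in> corn L. expo_deg m = top_deg}. Const (multinom m * b m) * z_pow m)"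
  proof (rule sum.mono_neutral_cong_right)
    show "\<forall>m\<in>corn L - {m \<in> corn L. expo_deg m = top_deg}. Const (b m) * coef_poly top_deg m = 0"
    proof
      fix m assume m: "m \<in> corn L - {m \<in> corn L. expo_deg m = top_deg}"
      then consider "b m = 0" | "expo_deg m < top_deg"
        using expo_deg_le_top_deg[of m] by fastforce
      then show "Const (b m) * coef_poly top_deg m = 0" by cases (simp_all add: coef_poly_eq_0)
    qed
  next
    fix m assume m: "m \<in> {m \<in> corn L. expo_deg m = top_deg}"
    then have "coef_poly top_deg m = Const (multinom m) * z_pow m"
      using below_corner top_deg_ge_2 by (intro coef_poly_top) auto
    then show "Const (b m) * coef_poly top_deg m = Const (multinom m * b m) * z_pow m"
      by (simp add: Const_mult mult_ac)
  qed auto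
  then show ?thesis using top_deg_ge_2 by (simp add: fpart_def)
qed

text \<open>Corners of degree \<open>top_deg - 1\<close> are filled by unit cells, those of degree
  \<open>top_deg\<close> with one cell of degree 2. For \<open>top_deg = 2\<close> this is the
  linear part \<open>z_corn\<close>, and there are no corners of degree 1.\<close>

lemma fpart_second:
  "fpart (top_deg - 1) = Const ((- 1) ^ (top_deg - 2) / of_nat (top_deg - 1)) *
      (\<Sum>m\<in>{m \<in> corn L. expo_deg m = top_deg - 1}. Const (multinom m * b m) * z_pow m)
    + Const ((- 1) ^ (top_deg - 2)) * (if top_deg = 2 then Var Corner else quad_sum L b top_deg)"
proof (cases "top_deg = 2")
  case True
  then have empty: "{m \<in> corn L. expo_deg m = top_deg - 1} = {}"
    using corn_deg_ge_2 by fastforce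
  show ?thesis unfolding empty using True by (simp add: fpart_def)
next
  case False
  define s where "s = top_deg - 1"
  have s: "top_deg = Suc s" "2 \<le> s" using False top_deg_ge_2 by (simp_all add: s_def)
  let ?t = "\<lambda>m. Const (b m) * coef_poly s m"
  define C1 where "C1 = {m \<in> corn L. expo_deg m = s}"
  define C2 where "C2 = {m \<in> corn L. expo_deg m = top_deg}"
  have "?t m = 0" if m: "m \<in> corn L - (C1 \<union> C2)" for m
  proof -
    consider "b m = 0" | "expo_deg m < s"
      using m expo_deg_le_top_deg[of m] s(1) by (fastforce simp: C1_def C2_def)
    then show ?thesis by cases (simp_all add: coef_poly_eq_0)
  qed
  then have "sum ?t (corn L) = sum ?t (C1 \<union> C2)"
    by (intro sum.mono_neutral_right) (auto simp: C1_def C2_def)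
  also have "\<dots> = sum ?t C1 + sum ?t C2"
    using s(1) by (intro sum.union_disjoint) (auto simp: C1_def C2_def)
  also have "sum ?t C1 = (\<Sum>m\<in>C1. Const (multinom m * b m) * z_pow m)"
  proof (intro sum.cong refl)
    fix m assume m: "m \<in> C1"
    then have "coef_poly s m = Const (multinom m) * z_pow m"
      using below_corner s(2) by (intro coef_poly_top) (auto simp: C1_def)
    then show "?t m = Const (multinom m * b m) * z_pow m" by (simp add: Const_mult mult_ac)
  qed
  also have "sum ?t C2 = Const (of_nat s) * quad_sum L b top_deg"
    unfolding quad_sum_def C2_def[symmetric] sum_distrib_left
  proof (intro sum.cong refl)
    fix m assume m: "m \<in> C2"
    then have "coef_poly s m = of_nat s * (\<Sum>n | expo_deg n = 2 \<and> n \<preccurlyeq> m.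
        Const (multinom (m - n)) * Var (Cell n) * z_pow (m - n))"
      using below_corner[of m] s by (intro coef_poly_second) (auto simp: C2_def)
    then show "?t m = (\<Sum>n\<in>{n. expo_deg n = 2 \<and> n \<preccurlyeq> m}. Const (of_nat s) *
        (Const (multinom (m - n) * b m) * Var (Cell n) * z_pow (m - n)))"
      by (simp add: Const_mult Const_of_nat sum_distrib_left mult_ac)
  qed
  finally have "fpart s = Const ((- 1) ^ (s - 1) / of_nat s) *
      ((\<Sum>m\<in>C1. Const (multinom m * b m) * z_pow m) + Const (of_nat s) * quad_sum L b top_deg)"
    using s(2) by (simp add: fpart_def)
  moreover have "Const ((- 1) ^ (s - 1) / of_nat s) * Const (of_nat s)
      = (Const ((- 1) ^ (s - 1)) :: ('k coord, 'a) mpoly)"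
    using s(2) by (simp flip: Const_mult)
  ultimately have "fpart s = Const ((- 1) ^ (s - 1) / of_nat s) *
      (\<Sum>m\<in>C1. Const (multinom m * b m) * z_pow m) + Const ((- 1) ^ (s - 1)) * quad_sum L b top_deg"
    by (simp add: distrib_left flip: mult.assoc)
  then show ?thesis using False s by (simp add: C1_def numeral_2_eq_2)
qed

text \<open>Distinct corners give distinct monomials in the \<open>z_i\<close>, so their terms
  cannot cancel. The comparison of coefficients takes place in \<open>h\<close>, the same sum
  written in variables indexed by \<open>'k\<close>.\<close>

lemma fpart_top_neq_0: "fpart top_deg \<noteq> 0"
proof
  assume zero: "fpart top_deg = 0"
  define C where "C = {m \<in> corn L. expo_deg m = top_deg}"
  define h where "h = (\<Sum>m\<in>C. Const (multinom m * b m) * monomial m :: ('k, 'a) mpoly)"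
  have fin: "finite C" by (simp add: C_def)
  have "meval y h = 0" for y
  proof -
    \<comment> \<open>The point with \<open>z_i = y i\<close>: \<open>THE\<close> inverts
      \<open>unit_cell\<close>, and the values elsewhere do not affect \<open>z_pow\<close>.\<close>
    define v where "v j = (case j of Cell l \<Rightarrow> y (THE i. l = unit_cell i) | Corner \<Rightarrow> 0)" for j
    have "(THE i'. unit_cell i = unit_cell i') = i" for i :: 'k
      by (rule the_equality) (auto dest: injD[OF inj_unit_cell])
    then have v: "(\<lambda>i. v (Cell (unit_cell i))) = y" by (simp add: v_def fun_eq_iff)
    have "meval v (fpart top_deg) = 0" by (simp add: zero)
    then have "meval v (\<Sum>m\<in>C. Const (multinom m * b m) * z_pow m) = 0"
      unfolding fpart_top using top_deg_ge_2 by (simp add: C_def)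
    then show ?thesis by (simp add: h_def meval_z_pow v)
  qed
  then have "h = 0" by (rule meval_eq_0_imp_0)
  obtain m where m: "m \<in> corn L" "b m \<noteq> 0" "expo_deg m = top_deg" using top_corner by blast
  have "Poly_Mapping.lookup h m = (\<Sum>n\<in>C. if n = m then multinom m * b m else 0)"
    unfolding h_def lookup_sum
    by (intro sum.cong) (auto simp: lookup_Const_mult monomial_def lookup_single when_def)
  also have "\<dots> = multinom m * b m" using m fin by (simp add: C_def)
  also have "\<dots> \<noteq> 0" using m by (simp add: multinom_def)
  finally show False using \<open>h = 0\<close> by simp
qed

lemma eqn_neq_0: "eqn \<noteq> 0"
proof
  assume "eqn = 0"
  then have "z0_decomposition L top_deg eqn (\<lambda>_. 0)"
    by (simp add: z0_decomposition_def)
  then have "fpart top_deg = 0"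
    using z0_decomposition_unique[OF z0_decomposition_eqn, of "\<lambda>_. 0" top_deg] top_deg_ge_2 by simp
  with fpart_top_neq_0 show False by simp
qed

section \<open>Divisibility by the equation\<close>

lemma eqn_linear_in_Corner:
  "\<exists>g. eqn = Var (Cell 0) ^ (top_deg - 1) * Var Corner + g \<and> mvars g \<subseteq> coords L - {Corner}"
proof (intro exI conjI)
  \<comment> \<open>Only the part of degree 1 contains \<open>z_corn\<close>, so it is split
    off.\<close>
  let ?g = "\<Sum>s=2..top_deg. Var (Cell 0) ^ (top_deg - s) * fpart s"
  have "{1..top_deg} = insert 1 {2..top_deg}" using top_deg_ge_2 by auto
  moreover have "fpart 1 = Var Corner" by (simp add: fpart_def)
  ultimately show "eqn = Var (Cell 0) ^ (top_deg - 1) * Var Corner + ?g"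
    by (simp add: eqn_def)
  have "mvars (Var (Cell 0) ^ e * fpart s) \<subseteq> coords L - {Corner}" if "s \<noteq> 1" for e s
    using mvars_Var0_fpart[of e s] mvars_fpart_ne_1[OF that] zero_in_coords by blast
  then show "mvars ?g \<subseteq> coords L - {Corner}"
    by (intro order.trans[OF mvars_sum] UN_least) auto
qed

text \<open>The equation is linear in \<open>z\<^sub>c\<^sub>o\<^sub>r\<^sub>n\<close> with leading coefficient a power of \<open>z\<^sub>0\<close>.\<close>

lemma pseudo_division:
  assumes "mvars G \<subseteq> coords L"
  shows "\<exists>N Q R. Var (Cell 0) ^ N * G = eqn * Q + R \<and> mvars R \<subseteq> coords L - {Corner}"
  using assms
proof (induction rule: mpoly_induct)
  case (Const c)
  show ?case by (rule exI[of _ 0], rule exI[of _ 0], rule exI[of _ "Const c"]) simp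
next
  case (Var i)
  show ?case
  proof (cases "i = Corner")
    case True
    obtain g where g: "eqn = Var (Cell 0) ^ (top_deg - 1) * Var Corner + g" "mvars g \<subseteq> coords L - {Corner}"
      using eqn_linear_in_Corner by blast
    \<comment> \<open>The variable \<open>z_corn\<close> is the only generator that needs reduction:
      \<open>z_0 ^ (top_deg - 1) * z_corn = eqn - g\<close>.\<close>
    show ?thesis
      by (rule exI[of _ "top_deg - 1"], rule exI[of _ 1], rule exI[of _ "- g"])
        (use g True in simp)
  next
    case False
    show ?thesis
      by (rule exI[of _ 0], rule exI[of _ 0], rule exI[of _ "Var i"]) (use Var False in simp)
  qed
next
  case (add p q)
  let ?x = "Var (Cell 0) :: ('k coord, 'a) mpoly"
  obtain N Q R where 1: "?x ^ N * p = eqn * Q + R" "mvars R \<subseteq> coords L - {Corner}"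
    using add.IH(1) by blast
  obtain N' Q' R' where 2: "?x ^ N' * q = eqn * Q' + R'" "mvars R' \<subseteq> coords L - {Corner}"
    using add.IH(2) by blast
  have x: "mvars (?x ^ n) \<subseteq> coords L - {Corner}" for n
    using mvars_power[of ?x n] zero_in_coords by auto
  have "?x ^ (N + N') * (p + q) = ?x ^ N' * (?x ^ N * p) + ?x ^ N * (?x ^ N' * q)"
    by (simp add: power_add algebra_simps)
  also have "\<dots> = eqn * (?x ^ N' * Q + ?x ^ N * Q') + (?x ^ N' * R + ?x ^ N * R')"
    unfolding 1 2 by (simp add: algebra_simps)
  finally have "?x ^ (N + N') * (p + q) = eqn * (?x ^ N' * Q + ?x ^ N * Q') + (?x ^ N' * R + ?x ^ N * R')" .
  moreover have "mvars (?x ^ N' * R + ?x ^ N * R') \<subseteq> coords L - {Corner}"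
    using mvars_add[of "?x ^ N' * R" "?x ^ N * R'"] mvars_mult[of "?x ^ N'" R]
      mvars_mult[of "?x ^ N" R'] x[of N] x[of N'] 1(2) 2(2) by blast
  ultimately show ?case by blast
next
  case (mult p q)
  let ?x = "Var (Cell 0) :: ('k coord, 'a) mpoly"
  obtain N Q R where 1: "?x ^ N * p = eqn * Q + R" "mvars R \<subseteq> coords L - {Corner}"
    using mult.IH(1) by blast
  obtain N' Q' R' where 2: "?x ^ N' * q = eqn * Q' + R'" "mvars R' \<subseteq> coords L - {Corner}"
    using mult.IH(2) by blast
  have "?x ^ (N + N') * (p * q) = (?x ^ N * p) * (?x ^ N' * q)"
    by (simp add: power_add algebra_simps)
  also have "\<dots> = eqn * (Q * (eqn * Q' + R') + R * Q') + R * R'"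
    unfolding 1 2 by (simp add: algebra_simps)
  finally have "?x ^ (N + N') * (p * q) = eqn * (Q * (eqn * Q' + R') + R * Q') + R * R'" .
  moreover have "mvars (R * R') \<subseteq> coords L - {Corner}"
    using mvars_mult[of R R'] 1(2) 2(2) by blast
  ultimately show ?case by blast
qed

text \<open>\<open>z\<^sub>0\<close> is prime and does not divide the equation, because \<open>f\<^sub>d \<noteq> 0\<close>.\<close>

lemma eqn_dvd_cancel_z0:
  assumes "eqn dvd Var (Cell 0) ^ N * G"
  shows "eqn dvd G"
  using assms
proof (induction N)
  case (Suc N)
  let ?x = "Var (Cell 0) :: ('k coord, 'a) mpoly"
  let ?s = "msubst Const (\<lambda>i. if i = Cell 0 then 0 else Var i) :: ('k coord, 'a) mpoly \<Rightarrow> _"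
  obtain Q where Q: "?x * (?x ^ N * G) = eqn * Q" using Suc.prems by (auto simp: mult.assoc)
  \<comment> \<open>At \<open>z_0 = 0\<close> only the summand without a power of \<open>z_0\<close>
    survives.\<close>
  have "?s eqn = (\<Sum>s=1..top_deg. if s = top_deg then ?s (fpart s) else 0)"
    unfolding eqn_def Const_hom.msubst_sum by (intro sum.cong) (auto simp: power_0_left)
  also have "\<dots> = ?s (fpart top_deg)" using top_deg_ge_2 by simp
  also have "\<dots> = fpart top_deg"
    using mvars_fpart[of top_deg] by (intro msubst_Const_ident) auto
  finally have "?s eqn \<noteq> 0" using fpart_top_neq_0 by simp
  moreover have "?s eqn * ?s Q = 0"
    using arg_cong[OF Q, of ?s] by simp
  ultimately have "?s Q = 0" using mpoly_no_zero_divisors by blast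
  then have "?x dvd Q" by (rule Var_dvd_if_subst_0)
  then obtain Q' where "Q = ?x * Q'" by (rule dvdE)
  then have "?x * (?x ^ N * G) = ?x * (eqn * Q')" using Q by (simp add: mult_ac)
  then have "?x ^ N * G = eqn * Q'" by (rule mpoly_mult_left_cancel[OF Var_neq_0])
  then show ?case by (intro Suc.IH) simp
qed simp

lemma eqn_dvd_if_vanishing:
  assumes "mvars G \<subseteq> coords L"
    and "\<And>q. Poly_Mapping.lookup q 0 \<noteq> 0 \<Longrightarrow> meval (co q) eqn = 0 \<Longrightarrow> meval (co q) G = 0"
  shows "eqn dvd G"
proof -
  let ?x = "Var (Cell 0) :: ('k coord, 'a) mpoly"
  obtain N Q R where N: "?x ^ N * G = eqn * Q + R" "mvars R \<subseteq> coords L - {Corner}"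
    using pseudo_division[OF assms(1)] by blast
  obtain g where g: "eqn = ?x ^ (top_deg - 1) * Var Corner + g" "mvars g \<subseteq> coords L - {Corner}"
    using eqn_linear_in_Corner by blast
  \<comment> \<open>The factor \<open>z_0\<close> takes care of the points with
    \<open>z_0 = 0\<close>, about which the assumption says nothing.\<close>
  have "meval v (?x * R) = 0" for v
  proof (cases "v (Cell 0) = 0")
    case False
    \<comment> \<open>The equation is solved for \<open>z_corn\<close>, which moves the point onto
      the cone; neither \<open>g\<close> nor \<open>R\<close> notices the change.\<close>
    define w where "w = v(Corner := - meval v g / v (Cell 0) ^ (top_deg - 1))"
    have "meval w g = meval v g" "meval w R = meval v R"
      using g(2) N(2) by (auto simp: w_def intro!: meval_cong)
    then have w_eqn: "meval w eqn = 0" using False by (simp add: g(1) w_def)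
    have lift: "meval w p = meval (co (lift w)) p" if "mvars p \<subseteq> coords L" for p
      using that by (intro meval_cong) (auto simp: co_lift)
    have "Poly_Mapping.lookup (lift w) 0 \<noteq> 0"
      using co_lift[of w "Cell 0"] zero_in_coords False by (simp add: co_Cell_0 w_def)
    then have "meval w G = 0"
      using assms(2)[of "lift w"] w_eqn by (simp add: lift assms(1) mvars_eqn)
    then have "meval w R = 0"
      using arg_cong[OF N(1), of "meval w"] w_eqn by simp
    then show ?thesis using \<open>meval w R = meval v R\<close> by simp
  qed simp
  then have "?x * R = 0" by (rule meval_eq_0_imp_0)
  then have "R = 0" using mpoly_no_zero_divisors[of ?x R] Var_neq_0 by metis
  then have "eqn dvd ?x ^ N * G" using N(1) by simp
  then show ?thesis by (rule eqn_dvd_cancel_z0)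
qed

subsection \<open>The hypersurface\<close>

lemma exp_cone_eqn:
  "{c \<odot>\<^bsub>A\<^esub> alg_exp A u | c u. c \<noteq> 0 \<and> u \<in> U_space L b} =
    {cls L b q | q. Poly_Mapping.lookup q 0 \<noteq> 0 \<and> meval (co q) eqn = 0}"
  unfolding exp_cone_eq by (auto simp: meval_eqn)

lemma meval_eqn_vanishing:
  assumes "eqn dvd G" "meval v eqn = 0"
  shows "meval v G = 0"
  using assms by (auto elim!: dvdE)

text \<open>The cone itself consists of the zeros of \<open>eqn\<close> with \<open>z_0\<close>
  non-zero. A polynomial vanishing there is a multiple of \<open>eqn\<close>, so the closure picks
  up all zeros with \<open>z_0 = 0\<close> as well.\<close>

lemma zariski_closure_cone:
  "zariski_closure A (coords L) (coord_of L b)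
      {c \<odot>\<^bsub>A\<^esub> alg_exp A u | c u. c \<noteq> 0 \<and> u \<in> U_space L b}
    = {a \<in> carrier A. meval (coord_of L b a) eqn = 0}" (is "?Z = ?E")
proof (intro subset_antisym subsetI)
  fix a assume "a \<in> ?Z"
  then show "a \<in> ?E"
    using mvars_eqn by (auto simp: zariski_closure_def exp_cone_eqn coord_of_cls)
next
  fix a assume a: "a \<in> ?E"
  have *: "meval (coord_of L b a) F = 0"
    if "mvars F \<subseteq> coords L" "\<And>q. Poly_Mapping.lookup q 0 \<noteq> 0 \<Longrightarrow> meval (co q) eqn = 0 \<Longrightarrow> meval (co q) F = 0"
    for F
    using a by (intro meval_eqn_vanishing[OF eqn_dvd_if_vanishing[OF that]]) auto
  have "meval (coord_of L b a) F = 0"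
    if "mvars F \<subseteq> coords L" "\<forall>s\<in>{cls L b q | q. Poly_Mapping.lookup q 0 \<noteq> 0 \<and> meval (co q) eqn = 0}.
      meval (coord_of L b s) F = 0" for F
  proof (rule *[OF that(1)])
    fix q assume "Poly_Mapping.lookup q 0 \<noteq> 0" "meval (co q) eqn = 0"
    then show "meval (co q) F = 0" using that(2) by (auto simp flip: coord_of_cls)
  qed
  then show "a \<in> ?Z"
    using a unfolding zariski_closure_def exp_cone_eqn by blast
qed

lemma X_hyp_eq: "X_hyp L b = zero_locus A (coord_of L b) eqn"
  unfolding X_hyp_def hpair_hypersurface_def zariski_closure_cone
  by (auto simp: zero_locus_def)

text \<open>Homogeneity makes vanishing independent of the representative chosen on a punctured
  line.\<close>

lemma proj_in_zero_locus:
  assumes "proj A (cls L b q) \<in> zero_locus A (coord_of L b) eqn"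
  shows "meval (co q) eqn = 0"
proof -
  obtain a where a: "proj A (cls L b q) = proj A a" "a \<in> carrier A" "meval (coord_of L b a) eqn = 0"
    using assms unfolding zero_locus_def by blast
  then obtain p where p: "proj A (cls L b q) = proj A (cls L b p)" "meval (co p) eqn = 0"
    by (auto simp: carrier_A coord_of_cls)
  have "cls L b q \<in> proj A (cls L b q)"
    by (auto simp: proj_def intro!: exI[of _ 1])
  then obtain c where "cls L b q = c \<odot>\<^bsub>A\<^esub> cls L b p"
    unfolding p(1) by (auto simp: proj_def)
  then have "co q = (\<lambda>j. c * co p j)" by (simp add: cls_eq_iff fun_eq_iff co_Const_mult)
  then show ?thesis using p(2) by (simp add: meval_homogeneous[OF homogeneous_eqn])
qed

text \<open>Points with \<open>z_0\<close> non-zero already force divisibility; conversely, a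
  multiple of \<open>eqn\<close> vanishes on every representative of a point of the
  hypersurface.\<close>

lemma defining_form_eqn:
  "defining_form A (coords L) (coord_of L b) (X_hyp L b) top_deg eqn"
  unfolding defining_form_def
proof (intro conjI allI impI)
  fix e and G :: "('k coord, 'a) mpoly"
  assume G: "mvars G \<subseteq> coords L \<and> homogeneous e G"
  show "(\<forall>a\<in>carrier A. a \<noteq> \<zero>\<^bsub>A\<^esub> \<and> proj A a \<in> X_hyp L b \<longrightarrow> meval (coord_of L b a) G = 0) \<longleftrightarrow> eqn dvd G"
  proof
    assume *: "\<forall>a\<in>carrier A. a \<noteq> \<zero>\<^bsub>A\<^esub> \<and> proj A a \<in> X_hyp L b \<longrightarrow> meval (coord_of L b a) G = 0"
    show "eqn dvd G"
    proof (rule eqn_dvd_if_vanishing)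
      fix q assume q: "Poly_Mapping.lookup q 0 \<noteq> 0" "meval (co q) eqn = 0"
      have "cls L b q \<noteq> \<zero>\<^bsub>A\<^esub>"
        using q(1) by (auto simp: zero_A cls_eq_iff simp flip: co_Cell_0)
      moreover have "proj A (cls L b q) \<in> X_hyp L b"
        using q(2) \<open>cls L b q \<noteq> \<zero>\<^bsub>A\<^esub>\<close> by (auto simp: X_hyp_eq zero_locus_def coord_of_cls)
      ultimately show "meval (co q) G = 0" using * by (auto simp: coord_of_cls)
    qed (use G in simp)
  next
    assume "eqn dvd G"
    then show "\<forall>a\<in>carrier A. a \<noteq> \<zero>\<^bsub>A\<^esub> \<and> proj A a \<in> X_hyp L b \<longrightarrow> meval (coord_of L b a) G = 0"
      by (auto simp: carrier_A coord_of_cls X_hyp_eq dest!: proj_in_zero_locus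
          intro: meval_eqn_vanishing)
  qed
qed (simp_all add: mvars_eqn eqn_neq_0 homogeneous_eqn X_hyp_eq)

text \<open>Two forms that generate the same vanishing ideal divide each other, hence have equal
  degree.\<close>

lemma X_degree_eq: "X_degree L b = top_deg"
  unfolding X_degree_def hypersurface_degree_def
proof (rule the_equality)
  show "\<exists>F. defining_form A (coords L) (coord_of L b) (X_hyp L b) top_deg F"
    using defining_form_eqn by blast
next
  fix d assume "\<exists>F. defining_form A (coords L) (coord_of L b) (X_hyp L b) d F"
  then obtain F where F: "defining_form A (coords L) (coord_of L b) (X_hyp L b) d F" by blast
  have dvd: "F dvd F'" if "defining_form A (coords L) (coord_of L b) (X_hyp L b) d F"
    "defining_form A (coords L) (coord_of L b) (X_hyp L b) d' F'" for d d' F F'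
  proof -
    have "\<forall>a\<in>carrier A. a \<noteq> \<zero>\<^bsub>A\<^esub> \<and> proj A a \<in> X_hyp L b \<longrightarrow> meval (coord_of L b a) F' = 0"
      using that(2) dvd_refl unfolding defining_form_def by blast
    then show ?thesis using that unfolding defining_form_def by blast
  qed
  have "F dvd eqn" "eqn dvd F"
    using dvd[OF F defining_form_eqn] dvd[OF defining_form_eqn F] by auto
  then show "d = top_deg"
    using F homogeneous_eqn eqn_neq_0
    by (intro order.antisym homogeneous_dvd_degree_le[of _ eqn _ F] homogeneous_dvd_degree_le[of _ F _ eqn])
      (auto simp: defining_form_def)
qed

end

theorem proposition6:
  fixes \<Lambda> :: "('k::finite) expo set"
    and b :: "'k expo \<Rightarrow> 'a::{alg_closed_field, field_char_0}"
    and d :: nat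
    and f :: "('k coord, 'a) mpoly"
  assumes "young_diagram \<Lambda>"
    and "non_exceptional \<Lambda>"
    and "\<exists>\<mu>\<in>corn \<Lambda>. b \<mu> \<noteq> 0"
    and "d = X_degree \<Lambda> b"
    and "f = X_equation \<Lambda> b d"
  shows "X_hyp \<Lambda> b = zero_locus (A_alg \<Lambda> b) (coord_of \<Lambda> b) f \<and>
    d = Max (expo_deg ` {\<mu> \<in> corn \<Lambda>. b \<mu> \<noteq> 0}) \<and>
    (\<exists>fs. z0_decomposition \<Lambda> d f fs) \<and>
    (\<forall>fs. z0_decomposition \<Lambda> d f fs \<longrightarrow>
      fs d = Const ((- 1) ^ (d - 1) / of_nat d) *
        (\<Sum>\<mu>\<in>{\<mu> \<in> corn \<Lambda>. expo_deg \<mu> = d}. Const (multinom \<mu> * b \<mu>) * z_pow \<mu>) \<and>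
      fs (d - 1) = Const ((- 1) ^ (d - 2) / of_nat (d - 1)) *
        (\<Sum>\<mu>\<in>{\<mu> \<in> corn \<Lambda>. expo_deg \<mu> = d - 1}. Const (multinom \<mu> * b \<mu>) * z_pow \<mu>)
        + Const ((- 1) ^ (d - 2)) * (if d = 2 then Var Corner else quad_sum \<Lambda> b d))"
proof -
  interpret young_pair \<Lambda> b by standard (use assms(1-3) in auto)
  have d: "d = top_deg" using assms(4) X_degree_eq by simp
  then have f: "f = eqn" using assms(5) X_equation_eq by simp
  \<comment> \<open>Uniqueness transfers the computed parts \<open>fpart\<close> to an arbitrary
    decomposition; \<open>top_deg_ge_2\<close> puts \<open>top_deg - 1\<close> into the index
    range.\<close>
  have parts: "fs top_deg = fpart top_deg" "fs (top_deg - 1) = fpart (top_deg - 1)"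
    if "z0_decomposition \<Lambda> top_deg eqn fs" for fs
    using z0_decomposition_unique[OF that, of fpart] z0_decomposition_eqn top_deg_ge_2
    by simp_all
  show ?thesis
    unfolding d f
    by (intro conjI allI impI exI; (fact X_hyp_eq top_deg_def z0_decomposition_eqn
        | erule trans[OF parts(1) fpart_top] | erule trans[OF parts(2) fpart_second]))
qed

end
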